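(* Let $\varphi$ be a holomorphic self-map of the unit ball $\mathbb{B}_n\subset\mathbb{C}^n$ and let $\psi\in H(\mathbb{B}_n)$. Let $W_{\psi,\varphi}f=\psi\,(f\circ\varphi)$. Then the following are equivalent: (a) $W_{\psi,\varphi}:H^\infty(\mathbb{B}_n)\to\mathcal{B}_0(\mathbb{B}_n)$ is bounded. (b) $W_{\psi,\varphi}:H^\infty(\mathbb{B}_n)\to\mathcal{B}_0(\mathbb{B}_n)$ is compact. (c) $\psi\in\mathcal{B}_0(\mathbb{B}_n)$ and $\displaystyle\lim_{\|z\|\to1}|\psi(z)|\,\theta_\varphi(z)=0$.
   Context: $\mathbb{B}_n=\{z\in\mathbb{C}^n:\|z\|<1\}$ with the Euclidean norm and $\langle u,v\rangle=\sum_j u_j\overline{v_j}$. $H(\mathbb{B}_n)$ is the set of holomorphic functions $\mathbb{B}_n\to\mathbb{C}$, and $H^\infty(\mathbb{B}_n)$ is the space of bounded ones with the supremum norm $\|\cdot\|_\infty$. Bergman metric: $H_z(u,\overline{v})=\frac{n+1}{2}\cdot\frac{(1-\|z\|^2)\langle u,v\rangle+\langle u,z\rangle\langle z,v\rangle}{(1-\|z\|^2)^2}$. For $f\in H(\mathbb{B}_n)$, let $Q_f(z)=\sup_{u\in\mathbb{C}^n\setminus\{0\}}\frac{\left|\sum_{k=1}^n\frac{\partial f}{\partial z_k}(z)u_k\right|}{H_z(u,\overline{u})^{1/2}}$ and $\beta_f=\sup_{z\in\mathbb{B}_n}Q_f(z)$. The Bloch space $\mathcal{B}(\mathbb{B}_n)=\{f\in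 H(\mathbb{B}_n):\beta_f<\infty\}$ has norm $\|f\|_{\mathcal{B}}=|f(0)|+\beta_f$. The little Bloch space $\mathcal{B}_0(\mathbb{B}_n)$ is the closure of the polynomials in $\mathcal{B}(\mathbb{B}_n)$, equivalently $\{f\in\mathcal{B}(\mathbb{B}_n):\lim_{\|z\|\to1}Q_f(z)=0\}$, with the same norm. $\theta_\varphi(z)=\sup\{Q_{f\circ\varphi}(z):f\in H^\infty(\mathbb{B}_n),\ \|f\|_\infty\le1\}$. "$W_{\psi,\varphi}:X\to Y$ is bounded (compact)" means that it maps $X$ into $Y$ and is a bounded (compact) linear operator. *)

theory Defs
  imports "HOL-Analysis.Analysis"
begin

text \<open>
  Points of \<open>\<complex>\<^sup>n\<close> are vectors of type \<^typ>\<open>complex ^ 'n\<close> with \<open>n = CARD('n) \<ge> 1\<close>; their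
  library norm is the Euclidean one. A function on the unit ball is a total function of which
  only the values on the ball matter; norms of functions are accordingly seminorms on total
  functions, and two functions that agree on the ball are at distance 0.
\<close>

abbreviation unit_ball :: "(complex ^ 'n) set" where
  "unit_ball \<equiv> ball 0 1"

definition hprod :: "complex ^ 'n \<Rightarrow> complex ^ 'n \<Rightarrow> complex" where
  "hprod u v = (\<Sum>j\<in>UNIV. u $ j * cnj (v $ j))"

text \<open>Holomorphy in several variables: a complex-linear Frechet derivative at every point.\<close>

definition holo_on_ball :: "(complex ^ 'n \<Rightarrow> complex) \<Rightarrow> bool" where
  "holo_on_ball f \<longleftrightarrow>
     (\<forall>z\<in>unit_ball. \<exists>D. (f has_derivative D) (at z) \<and> (\<forall>c v. D (c *s v) = c * D v))"

definition holo_self_map :: "(complex ^ 'n \<Rightarrow> complex ^ 'n) \<Rightarrow> bool" where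
  "holo_self_map \<phi> \<longleftrightarrow> (\<forall>i. holo_on_ball (\<lambda>z. \<phi> z $ i)) \<and> \<phi> ` unit_ball \<subseteq> unit_ball"

definition partial_deriv :: "'n \<Rightarrow> (complex ^ 'n \<Rightarrow> complex) \<Rightarrow> complex ^ 'n \<Rightarrow> complex" where
  "partial_deriv k f z = deriv (\<lambda>w. f (\<chi> j. if j = k then w else z $ j)) (z $ k)"

text \<open>\<open>bergman_metric z u v\<close> is \<open>H\<^sub>z(u, \<bar>v\<bar>)\<close>: the conjugation of \<open>v\<close> is built into the formula.\<close>

definition bergman_metric :: "complex ^ 'n \<Rightarrow> complex ^ 'n \<Rightarrow> complex ^ 'n \<Rightarrow> complex" where
  "bergman_metric z u v =
     (of_nat CARD('n) + 1) / 2 *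
     ((1 - of_real ((norm z)\<^sup>2)) * hprod u v + hprod u z * hprod z v)
     / (1 - of_real ((norm z)\<^sup>2))\<^sup>2"

text \<open>
  Suprema that might be infinite are taken in \<^typ>\<open>ennreal\<close>. \<open>H\<^sub>z(u, \<bar>u\<bar>)\<close> is real and positive
  for \<open>u \<noteq> 0\<close>, hence equal to its real part.
\<close>

definition Q :: "(complex ^ 'n \<Rightarrow> complex) \<Rightarrow> complex ^ 'n \<Rightarrow> ennreal" where
  "Q f z = (SUP u\<in>UNIV - {0}.
     ennreal (cmod (\<Sum>k\<in>UNIV. partial_deriv k f z * u $ k) / sqrt (Re (bergman_metric z u u))))"

definition bloch_seminorm :: "(complex ^ 'n \<Rightarrow> complex) \<Rightarrow> ennreal" where
  "bloch_seminorm f = (SUP z\<in>unit_ball. Q f z)"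

definition bloch :: "(complex ^ 'n \<Rightarrow> complex) set" where
  "bloch = {f. holo_on_ball f \<and> bloch_seminorm f < \<infinity>}"

definition bloch_norm :: "(complex ^ 'n \<Rightarrow> complex) \<Rightarrow> real" where
  "bloch_norm f = cmod (f 0) + enn2real (bloch_seminorm f)"

definition polynomials :: "(complex ^ 'n \<Rightarrow> complex) set" where
  "polynomials = {\<lambda>z. \<Sum>\<alpha>\<in>A. c \<alpha> * (\<Prod>i\<in>UNIV. z $ i ^ \<alpha> i) |
     (A :: ('n \<Rightarrow> nat) set) c. finite A}"

text \<open>
  The closure of the polynomials in the Bloch space. All polynomials are Bloch functions; the
  intersection only makes it evident that \<^const>\<open>bloch_norm\<close> is applied to a Bloch function.
\<close>

definition little_bloch :: "(complex ^ 'n \<Rightarrow> complex) set" where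
  "little_bloch = {f \<in> bloch. \<forall>\<epsilon>>0. \<exists>p\<in>polynomials \<inter> bloch. bloch_norm (\<lambda>z. f z - p z) < \<epsilon>}"

definition H_inf :: "(complex ^ 'n \<Rightarrow> complex) set" where
  "H_inf = {f. holo_on_ball f \<and> bounded (f ` unit_ball)}"

definition H_inf_norm :: "(complex ^ 'n \<Rightarrow> complex) \<Rightarrow> real" where
  "H_inf_norm f = (SUP z\<in>unit_ball. cmod (f z))"

definition theta :: "(complex ^ 'n \<Rightarrow> complex ^ 'n) \<Rightarrow> complex ^ 'n \<Rightarrow> ennreal" where
  "theta \<phi> z = (SUP f\<in>{f \<in> H_inf. H_inf_norm f \<le> 1}. Q (f \<circ> \<phi>) z)"

definition weighted_comp ::
  "(complex ^ 'n \<Rightarrow> complex) \<Rightarrow> (complex ^ 'n \<Rightarrow> complex ^ 'n)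
    \<Rightarrow> (complex ^ 'n \<Rightarrow> complex) \<Rightarrow> complex ^ 'n \<Rightarrow> complex" where
  "weighted_comp \<psi> \<phi> f = (\<lambda>z. \<psi> z * (f \<circ> \<phi>) z)"

text \<open>
  Operators between linear spaces \<open>X\<close>, \<open>Y\<close> of functions, with (semi)norms \<open>nX\<close>, \<open>nY\<close>.
\<close>

definition linear_operator ::
  "('a \<Rightarrow> complex) set \<Rightarrow> ('b \<Rightarrow> complex) set \<Rightarrow> (('a \<Rightarrow> complex) \<Rightarrow> 'b \<Rightarrow> complex) \<Rightarrow> bool" where
  "linear_operator X Y T \<longleftrightarrow>
     (\<forall>f\<in>X. T f \<in> Y) \<and>
     (\<forall>f\<in>X. \<forall>g\<in>X. T (\<lambda>x. f x + g x) = (\<lambda>y. T f y + T g y)) \<and>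
     (\<forall>c. \<forall>f\<in>X. T (\<lambda>x. c * f x) = (\<lambda>y. c * T f y))"

definition bounded_operator ::
  "('a \<Rightarrow> complex) set \<Rightarrow> (('a \<Rightarrow> complex) \<Rightarrow> real) \<Rightarrow>
   ('b \<Rightarrow> complex) set \<Rightarrow> (('b \<Rightarrow> complex) \<Rightarrow> real) \<Rightarrow>
   (('a \<Rightarrow> complex) \<Rightarrow> 'b \<Rightarrow> complex) \<Rightarrow> bool" where
  "bounded_operator X nX Y nY T \<longleftrightarrow>
     linear_operator X Y T \<and> (\<exists>C. \<forall>f\<in>X. nY (T f) \<le> C * nX f)"

definition compact_operator ::
  "('a \<Rightarrow> complex) set \<Rightarrow> (('a \<Rightarrow> complex) \<Rightarrow> real) \<Rightarrow>
   ('b \<Rightarrow> complex) set \<Rightarrow> (('b \<Rightarrow> complex) \<Rightarrow> real) \<Rightarrow>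
   (('a \<Rightarrow> complex) \<Rightarrow> 'b \<Rightarrow> complex) \<Rightarrow> bool" where
  "compact_operator X nX Y nY T \<longleftrightarrow>
     bounded_operator X nX Y nY T \<and>
     (\<forall>F M. (\<forall>k::nat. F k \<in> X \<and> nX (F k) \<le> M) \<longrightarrow>
        (\<exists>r g. strict_mono r \<and> g \<in> Y \<and>
           (\<lambda>k. nY (\<lambda>y. T (F (r k)) y - g y)) \<longlonglongrightarrow> 0))"

text \<open>The filter of \<open>\<parallel>z\<parallel> \<rightarrow> 1\<close> with \<open>z\<close> inside the ball.\<close>

definition to_sphere :: "(complex ^ 'n) filter" where
  "to_sphere = filtercomap norm (at_left 1)"

end

theory Submission
  imports Defs "HOL-Complex_Analysis.Great_Picard"
begin

text \<open>
  Since \<open>(\<psi> (f \<circ> \<phi>))' = \<psi> (f \<circ> \<phi>)' + \<psi>' (f \<circ> \<phi>)\<close>, condition (c) makes the Bloch quotient of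
  \<open>\<psi> (f \<circ> \<phi>)\<close> small near the sphere, uniformly for \<open>f\<close> in the unit ball of \<open>H\<^sup>\<infinity>\<close>; on a smaller
  ball Cauchy's estimate controls it by the size of \<open>f \<circ> \<phi>\<close>, and Montel's theorem gives compactness.

  Conversely, if the operator maps into the little Bloch space then \<open>|\<psi>(z)| Q\<^bsub>f \<circ> \<phi>\<^esub>(z) \<rightarrow> 0\<close> for each
  fixed \<open>f\<close>, and the point is uniformity in \<open>f\<close>. If it fails along points \<open>z\<^sub>k\<close>, then \<open>\<phi>(z\<^sub>k)\<close> must
  approach the sphere, and after passing to a convergent subsequence a gliding hump yields a single
  bounded \<open>f\<close> for which the convergence fails.

  Membership in the little Bloch space as a closure of polynomials is the vanishing of \<open>Q\<^sub>f\<close> at the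
  sphere: dilations \<open>f(rz)\<close> approximate \<open>f\<close>, and the homogeneous Taylor terms of \<open>f\<close> are polynomials
  because differentiating \<open>\<zeta> \<mapsto> f(\<zeta>z)\<close> gives \<open>\<Sum>\<^sub>k z\<^sub>k (\<partial>\<^sub>k f)(\<zeta>z)\<close>, which lowers the order by one.
\<close>

section \<open>Holomorphic functions of several variables\<close>

text \<open>The gliding hump starts from functions f_k over which nothing is known except |f_k|
  \<le> 1. With w_k = \<phi>(z_k) and a suitable direction v_k, the functionals g \<mapsto>
  Dg(w_k)v_k stay away from 0 on f_k and tend to 0 on every fixed bounded g. To make a sum of such
  functions bounded, each is multiplied by a peak function centred at w_k. The product rule then
  yields a derivative of the peak function, which is not controlled in the direction v_k;
  subtracting the constant f_k(w_k) first removes this term. The peak function is at/(a + t)^2 with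
  t = 1 - <z,\<xi>> and a = |t(w_k)|, where \<xi> is the limit of the w_k. On the ball t has
  positive real part, so the modulus is at most min(a/|t|, |t|/a), while it is at least 1/4 where
  |t| = a. Decay on one side only would let the humps pile up: for fixed z, scales far above and far
  below |t(z)| both occur. The scales a_k must tend to 0, and for this w_k must approach the sphere;
  hence the points where \<phi> stays in a smaller ball are treated separately.\<close>

definition holo_on :: "(complex ^ 'n) set \<Rightarrow> (complex ^ 'n \<Rightarrow> complex) \<Rightarrow> bool" where
  "holo_on S f \<longleftrightarrow> (\<forall>z\<in>S. \<exists>D. (f has_derivative D) (at z) \<and> (\<forall>c v. D (c *s v) = c * D v))"

abbreviation fd :: "(complex ^ 'n \<Rightarrow> complex) \<Rightarrow> complex ^ 'n \<Rightarrow> complex ^ 'n \<Rightarrow> complex" where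
  "fd f z \<equiv> frechet_derivative f (at z)"

lemma holo_on_ball_eq: "holo_on_ball f \<longleftrightarrow> holo_on unit_ball f"
  by (simp add: holo_on_ball_def holo_on_def)

lemma norm_smult_cvec: "norm (c *s v) = cmod c * norm (v :: complex ^ 'n)"
  by (simp add: norm_vec_def norm_mult L2_set_right_distrib)

lemma of_real_smult_cvec: "complex_of_real r *s v = r *\<^sub>R (v :: complex ^ 'n)"
  by (simp add: vec_eq_iff scaleR_conv_of_real[where 'a = complex])

lemma bounded_linear_smult_cvec: "bounded_linear (\<lambda>c. c *s (v :: complex ^ 'n))"
  by (rule bounded_linear_intro[where K = "norm v"])
     (auto simp: vec_eq_iff norm_smult_cvec algebra_simps)

lemma holo_onI:
  assumes "\<And>z. z \<in> S \<Longrightarrow> (f has_derivative D z) (at z)"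
    and "\<And>z c v. z \<in> S \<Longrightarrow> D z (c *s v) = c * D z v"
  shows "holo_on S f"
  using assms unfolding holo_on_def by blast

lemma
  assumes "holo_on S f" "z \<in> S"
  shows has_derivative_fd: "(f has_derivative fd f z) (at z)"
    and fd_smult: "fd f z (c *s v) = c * fd f z v"
proof -
  obtain D where D: "(f has_derivative D) (at z)" "\<And>c v. D (c *s v) = c * D v"
    using assms unfolding holo_on_def by blast
  then have "fd f z = D" by (metis frechet_derivative_at)
  with D show "(f has_derivative fd f z) (at z)" "fd f z (c *s v) = c * fd f z v" by auto
qed

lemma fd_eqI: "(f has_derivative D) (at z) \<Longrightarrow> fd f z = D"
  by (metis frechet_derivative_at)

lemma
  assumes "holo_on S f" "z \<in> S"
  shows linear_fd: "linear (fd f z)"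
    and fd_zero: "fd f z 0 = 0"
    and fd_scaleR: "fd f z (r *\<^sub>R v) = of_real r * fd f z v"
proof -
  show l: "linear (fd f z)"
    using has_derivative_fd[OF assms] has_derivative_linear by blast
  show "fd f z 0 = 0" "fd f z (r *\<^sub>R v) = of_real r * fd f z v"
    using linear_0[OF l] linear_cmul[OF l] by (auto simp: scaleR_conv_of_real)
qed

lemma holo_on_subset: "holo_on S f \<Longrightarrow> T \<subseteq> S \<Longrightarrow> holo_on T f"
  unfolding holo_on_def by blast

lemma holo_on_continuous_on: "holo_on S f \<Longrightarrow> continuous_on S f"
  by (meson continuous_at_imp_continuous_on has_derivative_continuous has_derivative_fd)

lemma
  assumes "holo_on S f" "holo_on S g"
  shows holo_on_add: "holo_on S (\<lambda>z. f z + g z)"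
    and fd_add: "z \<in> S \<Longrightarrow> fd (\<lambda>z. f z + g z) z v = fd f z v + fd g z v"
    and holo_on_diff: "holo_on S (\<lambda>z. f z - g z)"
    and fd_diff: "z \<in> S \<Longrightarrow> fd (\<lambda>z. f z - g z) z v = fd f z v - fd g z v"
    and holo_on_mult: "holo_on S (\<lambda>z. f z * g z)"
    and fd_mult: "z \<in> S \<Longrightarrow> fd (\<lambda>z. f z * g z) z v = f z * fd g z v + fd f z v * g z"
proof -
  note D = has_derivative_fd[OF assms(1)] has_derivative_fd[OF assms(2)]
  note s = fd_smult[OF assms(1)] fd_smult[OF assms(2)]
  note a = has_derivative_add[OF D] has_derivative_diff[OF D] has_derivative_mult[OF D]
  show "holo_on S (\<lambda>z. f z + g z)"
    by (rule holo_onI[OF a(1)]) (auto simp: s algebra_simps)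
  show "holo_on S (\<lambda>z. f z - g z)"
    by (rule holo_onI[OF a(2)]) (auto simp: s algebra_simps)
  show "holo_on S (\<lambda>z. f z * g z)"
    by (rule holo_onI[OF a(3)]) (auto simp: s algebra_simps)
  show "fd (\<lambda>z. f z + g z) z v = fd f z v + fd g z v" if "z \<in> S"
    using fd_eqI[OF a(1)[OF that that]] by simp
  show "fd (\<lambda>z. f z - g z) z v = fd f z v - fd g z v" if "z \<in> S"
    using fd_eqI[OF a(2)[OF that that]] by simp
  show "fd (\<lambda>z. f z * g z) z v = f z * fd g z v + fd f z v * g z" if "z \<in> S"
    using fd_eqI[OF a(3)[OF that that]] by simp
qed

lemma holo_on_const: "holo_on S (\<lambda>z. c)"
  by (rule holo_onI[where D = "\<lambda>_ _. 0"]) auto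

lemma fd_const: "fd (\<lambda>z. c) z v = 0"
  using fd_eqI[OF has_derivative_const, of c z] by (simp add: fun_eq_iff)

lemma
  assumes "holo_on S f"
  shows holo_on_cmult: "holo_on S (\<lambda>z. c * f z)"
    and fd_cmult: "z \<in> S \<Longrightarrow> fd (\<lambda>z. c * f z) z v = c * fd f z v"
  using holo_on_mult[OF holo_on_const assms] fd_mult[OF holo_on_const assms]
  by (auto simp: fd_const)

lemma has_derivative_nth_cvec: "((\<lambda>z. z $ i) has_derivative (\<lambda>v. v $ i)) (at (z :: complex ^ 'n))"
  by (intro bounded_linear_imp_has_derivative bounded_linear_vec_nth)

lemma holo_on_nth: "holo_on S (\<lambda>z. z $ i)"
  by (rule holo_onI[OF has_derivative_nth_cvec]) auto

lemma fd_nth: "fd (\<lambda>z. z $ i) z v = v $ i"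
  using fd_eqI[OF has_derivative_nth_cvec, of i z] by simp

lemma holo_on_sum: "(\<And>i. i \<in> I \<Longrightarrow> holo_on S (f i)) \<Longrightarrow> holo_on S (\<lambda>z. \<Sum>i\<in>I. f i z)"
  by (induction I rule: infinite_finite_induct) (auto intro!: holo_on_const holo_on_add)

lemma fd_sum:
  "(\<And>i. i \<in> I \<Longrightarrow> holo_on S (f i)) \<Longrightarrow> z \<in> S \<Longrightarrow>
     fd (\<lambda>z. \<Sum>i\<in>I. f i z) z v = (\<Sum>i\<in>I. fd (f i) z v)"
proof (induction I rule: infinite_finite_induct)
  case (insert x F)
  then show ?case
    using fd_add[of S "f x" "\<lambda>z. \<Sum>i\<in>F. f i z" z v] holo_on_sum[of F S f] by simp
qed (auto simp: fd_const)

lemma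
  assumes "\<And>i. holo_on S (\<lambda>z. \<phi> z $ i)" "\<phi> ` S \<subseteq> T" "holo_on T f"
  shows holo_on_compose: "holo_on S (f \<circ> \<phi>)"
    and fd_compose: "z \<in> S \<Longrightarrow> fd (f \<circ> \<phi>) z v = fd f (\<phi> z) (\<chi> i. fd (\<lambda>z. \<phi> z $ i) z v)"
proof -
  have d: "(\<phi> has_derivative (\<lambda>v. \<chi> i. fd (\<lambda>z. \<phi> z $ i) z v)) (at z)" if "z \<in> S" for z
    \<comment> \<open>The real basis vectors are \<open>axis i c\<close> with \<open>c\<close> equal
      to 1 or the imaginary unit, so the inner product with one of them is the real or imaginary
      part of a component of \<phi>.\<close>
    unfolding has_derivative_componentwise_within[of \<phi>]
  proof
    fix b :: "complex ^ 'a"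
    assume "b \<in> Basis"
    then obtain i c where b: "b = axis i c" "c \<in> Basis" by (auto simp: Basis_vec_def)
    show "((\<lambda>x. \<phi> x \<bullet> b) has_derivative (\<lambda>x. (\<chi> i. fd (\<lambda>z. \<phi> z $ i) z x) \<bullet> b)) (at z)"
      using has_derivative_inner_left[OF has_derivative_fd[OF assms(1)[of i] that], of c]
      by (simp add: b inner_axis)
  qed
  have c: "(f \<circ> \<phi> has_derivative fd f (\<phi> z) \<circ> (\<lambda>v. \<chi> i. fd (\<lambda>z. \<phi> z $ i) z v)) (at z)"
    if "z \<in> S" for z
    using diff_chain_at[OF d[OF that] has_derivative_fd[OF assms(3)]] assms(2) that by blast
  show "holo_on S (f \<circ> \<phi>)"
  proof (rule holo_onI[OF c])
    fix z c v assume z: "z \<in> S"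
    have "(\<chi> i. fd (\<lambda>z. \<phi> z $ i) z (c *s v)) = c *s (\<chi> i. fd (\<lambda>z. \<phi> z $ i) z v)"
      by (simp add: vec_eq_iff fd_smult[OF assms(1) z])
    then show "(fd f (\<phi> z) \<circ> (\<lambda>v. \<chi> i. fd (\<lambda>z. \<phi> z $ i) z v)) (c *s v) =
        c * (fd f (\<phi> z) \<circ> (\<lambda>v. \<chi> i. fd (\<lambda>z. \<phi> z $ i) z v)) v"
      using z assms(2) by (auto simp: fd_smult[OF assms(3)])
  qed
  show "fd (f \<circ> \<phi>) z v = fd f (\<phi> z) (\<chi> i. fd (\<lambda>z. \<phi> z $ i) z v)" if "z \<in> S"
    using fd_eqI[OF c[OF that]] by simp
qed

lemma holo_on_field_compose:
  assumes "holo_on S f" and g: "\<And>z. z \<in> S \<Longrightarrow> (g has_field_derivative g' (f z)) (at (f z))"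
  shows "holo_on S (\<lambda>z. g (f z))"
proof (rule holo_onI[where D = "\<lambda>z v. g' (f z) * fd f z v"])
  show "((\<lambda>z. g (f z)) has_derivative (\<lambda>v. g' (f z) * fd f z v)) (at z)" if "z \<in> S" for z
    using diff_chain_at[OF has_derivative_fd[OF assms(1) that]
        g[OF that, unfolded has_field_derivative_def]] by (simp add: o_def)
qed (simp add: fd_smult[OF assms(1)])

text \<open>Complex linearity of the derivative makes the restriction to a complex line complex
  differentiable. Through this the one-variable Cauchy theory enters.\<close>

lemma holo_on_line:
  assumes "holo_on S f" "z + \<zeta> *s v \<in> S"
  shows "((\<lambda>\<zeta>. f (z + \<zeta> *s v)) has_field_derivative fd f (z + \<zeta> *s v) v) (at \<zeta>)"
proof -
  have "((\<lambda>\<zeta>. z + \<zeta> *s v) has_derivative (\<lambda>h. h *s v)) (at \<zeta>)"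
    using has_derivative_add[OF has_derivative_const
        bounded_linear_imp_has_derivative[OF bounded_linear_smult_cvec]] by fastforce
  from diff_chain_at[OF this has_derivative_fd[OF assms]]
  show ?thesis
    using fd_smult[OF assms] by (simp add: has_field_derivative_def o_def mult.commute[of _ "fd f (z + \<zeta> *s v) v"])
qed

section \<open>Cauchy estimates and locally uniform limits\<close>

lemma holomorphic_onI_deriv:
  "(\<And>x. x \<in> U \<Longrightarrow> (g has_field_derivative g' x) (at x)) \<Longrightarrow> g holomorphic_on U"
  unfolding holomorphic_on_def field_differentiable_def using has_field_derivative_at_within by blast

text \<open>Cauchy's inequality on the disc of radius \<open>r\<close> in the complex line through
  \<open>z\<close> spanned by the unit vector \<open>e\<close> in the direction of \<open>v\<close>;
  a general \<open>v\<close> follows by real homogeneity.\<close>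

lemma fd_bound:
  assumes f: "holo_on S f" and S: "cball z r \<subseteq> S" and r: "0 < r"
    and M: "\<And>w. w \<in> cball z r \<Longrightarrow> cmod (f w) \<le> M"
  shows "cmod (fd f z v) \<le> M / r * norm v"
proof (cases "v = 0")
  case True
  have "z \<in> S" using S r by auto
  then show ?thesis using True fd_zero[OF f] by simp
next
  case False
  define e where "e = (1 / norm v) *\<^sub>R v"
  have ne: "norm e = 1" and v: "v = norm v *\<^sub>R e" using False by (auto simp: e_def)
  have inn: "z + \<zeta> *s e \<in> cball z r" if "cmod \<zeta> \<le> r" for \<zeta>
    using that by (simp add: dist_norm norm_smult_cvec ne)
  define g where "g = (\<lambda>\<zeta>. f (z + \<zeta> *s e))"
  have g: "(g has_field_derivative fd f (z + \<zeta> *s e) e) (at \<zeta>)" if "cmod \<zeta> \<le> r" for \<zeta>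
    unfolding g_def using holo_on_line[OF f, of z \<zeta> e] inn[OF that] S by blast
  have "cmod ((deriv ^^ 1) g 0) \<le> fact 1 * M / r ^ 1"
  proof (rule Cauchy_inequality[OF _ _ r])
    show "g holomorphic_on ball 0 r"
      by (rule holomorphic_onI_deriv, rule g) auto
    show "continuous_on (cball 0 r) g"
      by (intro continuous_at_imp_continuous_on ballI) (use g DERIV_isCont in auto)
    show "cmod (g x) \<le> M" if "cmod (0 - x) = r" for x
      using M inn that by (simp add: g_def)
  qed
  moreover have "deriv g 0 = fd f z e" using DERIV_imp_deriv[OF g[of 0]] r by simp
  ultimately have e: "cmod (fd f z e) \<le> M / r" by simp
  have zS: "z \<in> S" using S r by auto
  have "fd f z v = of_real (norm v) * fd f z e"
    by (subst v, subst fd_scaleR[OF f zS]) (use ne in simp)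
  then have "cmod (fd f z v) = norm v * cmod (fd f z e)" by (simp add: norm_mult)
  also have "\<dots> \<le> norm v * (M / r)" by (intro mult_left_mono e) simp
  finally show ?thesis by (simp add: mult.commute)
qed

text \<open>By Cauchy's estimate, uniform convergence on a ball makes the derivatives uniformly
  Cauchy on the concentric ball of half the radius. This is the input for differentiating a limit
  term by term.\<close>

lemma holo_on_uniform_limit:
  fixes f :: "nat \<Rightarrow> complex ^ 'n \<Rightarrow> complex"
  assumes f: "\<And>n. holo_on S (f n)"
    and lim: "\<And>z. z \<in> S \<Longrightarrow> \<exists>r>0. cball z r \<subseteq> S \<and> uniform_limit (cball z r) f g sequentially"
  shows "holo_on S g"
    and "z \<in> S \<Longrightarrow> (\<lambda>n. fd (f n) z v) \<longlonglongrightarrow> fd g z v"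
proof -
  have main: "\<exists>D. (g has_derivative D) (at z) \<and> (\<forall>v. (\<lambda>n. fd (f n) z v) \<longlonglongrightarrow> D v) \<and>
      (\<forall>c v. D (c *s v) = c * D v)" if z: "z \<in> S" for z
  proof -
    obtain r where r: "r > 0" and rS: "cball z r \<subseteq> S" and ul: "uniform_limit (cball z r) f g sequentially"
      using lim[OF z] by blast
    define T where "T = ball z (r/2)"
    have TS: "T \<subseteq> cball z r" unfolding T_def using r by auto
    have zT: "z \<in> T" using r by (simp add: T_def)
    have sub: "cball x (r/2) \<subseteq> cball z r" if "x \<in> T" for x
    proof
      fix y assume "y \<in> cball x (r/2)"
      then show "y \<in> cball z r" using that dist_triangle[of z y x] by (auto simp: T_def)
    qed
    have C: "\<exists>N. \<forall>m\<ge>N. \<forall>n\<ge>N. \<forall>x\<in>T. \<forall>h. cmod (fd (f n) x h - fd (f m) x h) \<le> e * norm h"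
      if e: "e > 0" for e :: real
    proof -
      \<comment> \<open>Two errors of \<open>e * r / 4\<close> add up to \<open>e * r / 2\<close>,
        and Cauchy's estimate on a ball of radius \<open>r / 2\<close> turns this into
        \<open>e\<close>.\<close>
      obtain N where N: "\<And>n w. n \<ge> N \<Longrightarrow> w \<in> cball z r \<Longrightarrow> dist (f n w) (g w) < e * r / 4"
        using uniform_limitD[OF ul, of "e * r / 4"] e r by (force simp: eventually_sequentially)
      show ?thesis
      proof (intro exI allI impI ballI)
        fix m n x h assume mn: "m \<ge> N" "n \<ge> N" and x: "x \<in> T"
        have "cmod (fd (\<lambda>w. f n w - f m w) x h) \<le> (e * r / 2) / (r / 2) * norm h"
        proof (rule fd_bound[OF holo_on_diff[OF f f]])
          show "cball x (r/2) \<subseteq> S" using sub[OF x] rS by blast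
          show "cmod (f n w - f m w) \<le> e * r / 2" if "w \<in> cball x (r/2)" for w
          proof -
            have w: "w \<in> cball z r" using sub[OF x] that by blast
            show ?thesis
              using N[OF mn(1) w] N[OF mn(2) w] dist_triangle2[of "f n w" "f m w" "g w"]
              by (simp add: dist_norm)
          qed
        qed (use r in auto)
        moreover have "x \<in> S" using x TS rS by blast
        ultimately show "cmod (fd (f n) x h - fd (f m) x h) \<le> e * norm h"
          using r by (simp add: fd_diff[OF f f])
      qed
    qed
    define D where "D = (\<lambda>x h. lim (\<lambda>n. fd (f n) x h))"
    have D: "(\<lambda>n. fd (f n) x h) \<longlonglongrightarrow> D x h" if x: "x \<in> T" for x h
    proof -
      have "Cauchy (\<lambda>n. fd (f n) x h)"
      proof (rule metric_CauchyI)
        fix e :: real assume e: "e > 0"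
        \<comment> \<open>The summand 1 keeps the denominator positive when \<open>h\<close> is
          0.\<close>
        define e' where "e' = e / 2 / (1 + norm h)"
        have pos: "1 + norm h > 0" using norm_ge_zero[of h] by linarith
        have e': "e' > 0" using e pos by (simp add: e'_def)
        have lt: "e' * norm h < e"
        proof -
          have "e' * norm h \<le> e' * (1 + norm h)" using e' by simp
          also have "\<dots> = e / 2" by (rule iffD1[OF nonzero_eq_divide_eq e'_def]) (use pos in linarith)
          finally show ?thesis using e by linarith
        qed
        show "\<exists>M. \<forall>m\<ge>M. \<forall>n\<ge>M. dist (fd (f m) x h) (fd (f n) x h) < e"
        proof -
          obtain N where N: "cmod (fd (f n) x h - fd (f m) x h) \<le> e' * norm h" if "m \<ge> N" "n \<ge> N" for m n
            using C[OF e'] x by blast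
          have "dist (fd (f m) x h) (fd (f n) x h) < e" if "m \<ge> N" "n \<ge> N" for m n
            using le_less_trans[OF N[OF that] lt] by (simp add: dist_norm norm_minus_commute)
          then show ?thesis by blast
        qed
      qed
      then show ?thesis
        unfolding D_def using Cauchy_convergent convergent_LIMSEQ_iff by blast
    qed
    have "\<exists>g2. \<forall>x\<in>T. (\<lambda>n. f n x) \<longlonglongrightarrow> g2 x \<and> (g2 has_derivative D x) (at x within T)"
    proof (rule has_derivative_sequence[where f' = "\<lambda>n. fd (f n)"])
      show "convex T" by (simp add: T_def)
      show "(f n has_derivative fd (f n) x) (at x within T)" if "x \<in> T" for n x
        using has_derivative_fd[OF f] that TS rS has_derivative_at_withinI by blast
      show "\<forall>\<^sub>F n in sequentially. \<forall>x\<in>T. \<forall>h. cmod (fd (f n) x h - D x h) \<le> e * norm h" if e: "e > 0" for e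
      proof -
        obtain N where N: "\<And>m n x h. m \<ge> N \<Longrightarrow> n \<ge> N \<Longrightarrow> x \<in> T \<Longrightarrow> cmod (fd (f n) x h - fd (f m) x h) \<le> e * norm h"
          using C[OF e] by blast
        have "cmod (fd (f n) x h - D x h) \<le> e * norm h" if "n \<ge> N" "x \<in> T" for n x h
        proof (rule tendsto_upperbound)
          show "(\<lambda>m. cmod (fd (f n) x h - fd (f m) x h)) \<longlonglongrightarrow> cmod (fd (f n) x h - D x h)"
            by (intro tendsto_intros D that)
          show "\<forall>\<^sub>F m in sequentially. cmod (fd (f n) x h - fd (f m) x h) \<le> e * norm h"
            unfolding eventually_sequentially using N that by blast
        qed simp
        then show ?thesis unfolding eventually_sequentially by blast
      qed
      show "z \<in> T" by fact
      show "(\<lambda>n. f n z) \<longlonglongrightarrow> g z"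
        using tendsto_uniform_limitI[OF ul] zT TS by blast
    qed
    then obtain g2 where g2: "\<And>x. x \<in> T \<Longrightarrow> (\<lambda>n. f n x) \<longlonglongrightarrow> g2 x"
        "\<And>x. x \<in> T \<Longrightarrow> (g2 has_derivative D x) (at x within T)" by blast
    \<comment> \<open>The theorem on sequences of derivatives provides only some limit function
      \<open>g2\<close>; uniqueness of pointwise limits identifies it with \<open>g\<close> on
      \<open>T\<close>.\<close>
    have eq: "g2 x = g x" if "x \<in> T" for x
      using LIMSEQ_unique[OF g2(1)[OF that] tendsto_uniform_limitI[OF ul]] that TS by blast
    have "open T" by (simp add: T_def)
    then have "(g2 has_derivative D z) (at z)"
      using g2(2)[OF zT] at_within_open[OF zT] by metis
    then have "(g has_derivative D z) (at z)"
      using has_derivative_transform_within_open[OF _ \<open>open T\<close> zT] eq by blast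
    moreover have "D z (c *s v) = c * D z v" for c v
    proof -
      have "(\<lambda>n. fd (f n) z (c *s v)) \<longlonglongrightarrow> c * D z v"
        unfolding fd_smult[OF f z] by (intro tendsto_intros D zT)
      then show ?thesis using LIMSEQ_unique D[OF zT] by blast
    qed
    ultimately show ?thesis using D[OF zT] by blast
  qed
  show "holo_on S g" unfolding holo_on_def using main by blast
  show "(\<lambda>n. fd (f n) z v) \<longlonglongrightarrow> fd g z v" if "z \<in> S"
    using main[OF that] fd_eqI by blast
qed

text \<open>For |x| \<le> s/2 the disc of radius s/2 about x stays where \<open>g\<close> is bounded
  by M, so Cauchy gives |g''(x)| \<le> 2M/(s/2)^2 = 8M/s^2, and Taylor's theorem does the rest. The
  point is that the bound depends on \<open>g\<close> only through M.\<close>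

lemma holomorphic_first_order_remainder:
  assumes g: "g holomorphic_on ball 0 (2 * s)" and s: "0 < s"
    and M: "\<And>x. cmod x \<le> s \<Longrightarrow> cmod (g x) \<le> M" and h: "cmod h \<le> s / 2"
  shows "cmod (g h - g 0 - h * deriv g 0) \<le> 8 * M / s\<^sup>2 * (cmod h)\<^sup>2"
proof -
  have "cmod ((deriv ^^ 0) g h - (\<Sum>i\<le>1. (deriv ^^ i) g 0 * (h - 0) ^ i / fact i))
      \<le> 8 * M / s\<^sup>2 * cmod (h - 0) ^ Suc 1 / fact 1"
  proof (rule complex_Taylor)
    show "convex (cball 0 (s/2) :: complex set)" by simp
    show "((deriv ^^ i) g has_field_derivative (deriv ^^ Suc i) g x) (at x within cball 0 (s/2))"
      if "x \<in> cball 0 (s/2)" for i x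
    proof -
      have "((deriv ^^ i) g has_field_derivative (deriv ^^ Suc i) g x) (at x)"
        by (rule has_field_derivative_higher_deriv[OF g]) (use that s in auto)
      then show ?thesis using has_field_derivative_at_within by blast
    qed
    show "cmod ((deriv ^^ Suc 1) g x) \<le> 8 * M / s\<^sup>2" if x: "x \<in> cball 0 (s/2)" for x
    proof -
      have c: "cmod y \<le> s" if "y \<in> cball x (s/2)" for y
        using x that norm_triangle_sub[of y x] by (auto simp: dist_norm norm_minus_commute)
      have sub: "cball x (s/2) \<subseteq> ball 0 (2 * s)" using c s by force
      have "cmod ((deriv ^^ 2) g x) \<le> fact 2 * M / (s/2) ^ 2"
      proof (rule Cauchy_inequality)
        show "g holomorphic_on ball x (s/2)"
          using g sub holomorphic_on_subset ball_subset_cball by (metis order_trans)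
        show "continuous_on (cball x (s/2)) g"
          using g sub holomorphic_on_imp_continuous_on continuous_on_subset by blast
        show "cmod (g y) \<le> M" if "cmod (x - y) = s/2" for y
          using M c that by (simp add: dist_norm)
      qed (use s in simp)
      then show ?thesis by (simp add: power2_eq_square numeral_2_eq_2)
    qed
    show "0 \<in> cball 0 (s/2)" "h \<in> cball 0 (s/2)" using s h by (auto simp: dist_norm)
  qed
  then show ?thesis by (simp add: power2_eq_square algebra_simps)
qed

lemma holo_on_translate:
  assumes "holo_on T f" "\<And>z. z \<in> S \<Longrightarrow> z + c \<in> T"
  shows "holo_on S (\<lambda>z. f (z + c))"
proof -
  have "holo_on S (\<lambda>z. (z + c) $ i)" for i
    by (simp add: holo_on_add holo_on_nth holo_on_const)
  then show ?thesis
    using holo_on_compose[of S "\<lambda>z. z + c" T f] assms by (auto simp: o_def)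
qed

text \<open>The difference quotients in direction \<open>e\<close> are holomorphic, and by the
  preceding remainder estimate they converge to the directional derivative locally
  uniformly.\<close>

lemma holo_on_directional:
  fixes f :: "complex ^ 'n \<Rightarrow> complex"
  assumes "open S" and f: "holo_on S f"
  shows "holo_on S (\<lambda>z. fd f z e)"
proof -
  have "\<exists>r>0. holo_on (ball z r) (\<lambda>z. fd f z e)" if z: "z \<in> S" for z
  proof -
    obtain R where R: "R > 0" "cball z R \<subseteq> S" using \<open>open S\<close> z open_contains_cball by blast
    \<comment> \<open>Three radii are spent: one for the position of the base point
      \<open>x\<close>, and two for moving along \<open>e\<close> with a parameter of modulus up to
      \<open>2 * s\<close>, the disc required by the remainder estimate.\<close>
    define r where "r = R / 3"
    have r: "r > 0" "cball z (3 * r) \<subseteq> S" using R by (auto simp: r_def)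
    define s where "s = r / (1 + norm e)"
    have pos: "1 + norm e > 0" using norm_ge_zero[of e] by linarith
    have s: "s > 0" and se: "s * norm e \<le> r"
    proof -
      show "s > 0" using pos r by (simp add: s_def)
      then have "s * norm e \<le> s * (1 + norm e)" by simp
      also have "\<dots> = r" using pos by (auto simp: s_def)
      finally show "s * norm e \<le> r" .
    qed
    have move: "x + \<zeta> *s e \<in> cball z (r + c * r)" if "x \<in> ball z r" "cmod \<zeta> \<le> c * s" "c \<ge> 0" for x \<zeta> c
    proof -
      have "norm (\<zeta> *s e) \<le> c * s * norm e"
        unfolding norm_smult_cvec by (intro mult_right_mono that) simp
      also have "\<dots> \<le> c * r" using mult_left_mono[OF se that(3)] by (simp add: mult.assoc)
      finally have "norm (\<zeta> *s e) \<le> c * r" .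
      then have "dist x (x + \<zeta> *s e) \<le> c * r" by (simp add: dist_norm)
      then show ?thesis
        using dist_triangle[of z "x + \<zeta> *s e" x] that(1) by simp
    qed
    have "compact (f ` cball z (3 * r))"
      by (rule compact_continuous_image[OF continuous_on_subset[OF holo_on_continuous_on[OF f] r(2)] compact_cball])
    then obtain M where M: "\<And>w. w \<in> cball z (3 * r) \<Longrightarrow> cmod (f w) \<le> M"
      using compact_imp_bounded bounded_iff by (metis imageI)
    \<comment> \<open>Steps must stay positive and at most \<open>s / 2\<close>, already for
      \<open>n = 0\<close>.\<close>
    define h where "h = (\<lambda>n. s / real (n + 2))"
    have h: "h n > 0" "h n \<le> s / 2" for n
    proof -
      have "s / real (n + 2) \<le> s / 2" by (rule divide_left_mono) (use s in auto)
      then show "h n > 0" "h n \<le> s / 2" using s by (auto simp: h_def)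
    qed
    have h0: "h \<longlonglongrightarrow> 0"
      unfolding h_def using LIMSEQ_ignore_initial_segment[OF lim_const_over_n[of s], of 2] by simp
    define D where "D = (\<lambda>n x. (1 / of_real (h n)) * (f (x + of_real (h n) *s e) - f x))"
    have "holo_on (ball z r) (\<lambda>z. fd f z e)"
    proof (rule holo_on_uniform_limit(1)[where f = D])
      show "holo_on (ball z r) (D n)" for n
        unfolding D_def
      proof (intro holo_on_cmult holo_on_diff)
        show "holo_on (ball z r) (\<lambda>z. f (z + of_real (h n) *s e))"
        proof (rule holo_on_translate[OF f])
          fix x assume "x \<in> ball z r"
          then show "x + of_real (h n) *s e \<in> S"
            using move[of x "of_real (h n)" 1] h[of n] s r by force
        qed
        have "ball z r \<subseteq> S" using r(2) r(1) by force
        then show "holo_on (ball z r) f" using f holo_on_subset by blast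
      qed
      have est: "cmod (D n x - fd f x e) \<le> 8 * M / s\<^sup>2 * h n" if x: "x \<in> ball z r" for n x
      proof -
        define g where "g = (\<lambda>\<zeta>. f (x + \<zeta> *s e))"
        have g: "(g has_field_derivative fd f (x + \<zeta> *s e) e) (at \<zeta>)" if "cmod \<zeta> < 2 * s" for \<zeta>
          unfolding g_def
        proof (rule holo_on_line[OF f])
          show "x + \<zeta> *s e \<in> S" using move[of x \<zeta> 2] x that r by auto
        qed
        have "cmod (g (h n) - g 0 - h n * deriv g 0) \<le> 8 * M / s\<^sup>2 * (cmod (h n))\<^sup>2"
        proof (rule holomorphic_first_order_remainder)
          show "g holomorphic_on ball 0 (2 * s)"
            by (rule holomorphic_onI_deriv, rule g) auto
          show "cmod (g y) \<le> M" if "cmod y \<le> s" for y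
            unfolding g_def using M move[of x y 1] x that r by auto
        qed (use s h[of n] in auto)
        moreover have "deriv g 0 = fd f x e" using DERIV_imp_deriv[OF g[of 0]] s by simp
        moreover have "g (h n) - g 0 - h n * deriv g 0 = of_real (h n) * (D n x - deriv g 0)"
          using h[of n] by (simp add: D_def g_def algebra_simps)
        ultimately have "h n * cmod (D n x - fd f x e) \<le> h n * (8 * M / s\<^sup>2 * h n)"
          using h[of n] by (simp add: norm_mult power2_eq_square mult_ac)
        then show ?thesis using h(1)[of n] by (simp only: mult_le_cancel_left_pos)
      qed
      fix y assume y: "y \<in> ball z r"
      obtain t where t: "t > 0" "cball y t \<subseteq> ball z r" using y open_contains_cball[of "ball z r"] open_ball by blast
      have "uniform_limit (cball y t) D (\<lambda>z. fd f z e) sequentially"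
      proof (rule uniform_limitI)
        fix \<epsilon> :: real assume "\<epsilon> > 0"
        have "(\<lambda>n. 8 * M / s\<^sup>2 * h n) \<longlonglongrightarrow> 8 * M / s\<^sup>2 * 0" by (intro tendsto_intros h0)
        then have "\<forall>\<^sub>F n in sequentially. 8 * M / s\<^sup>2 * h n < \<epsilon>"
          using order_tendstoD(2) \<open>\<epsilon> > 0\<close> by fastforce
        then show "\<forall>\<^sub>F n in sequentially. \<forall>x\<in>cball y t. dist (D n x) (fd f x e) < \<epsilon>"
        proof eventually_elim
          case (elim n)
          have "dist (D n x) (fd f x e) < \<epsilon>" if "x \<in> cball y t" for x
            using le_less_trans[OF est elim, of x] that t(2) by (auto simp: dist_norm)
          then show ?case by blast
        qed
      qed
      with t show "\<exists>r'>0. cball y r' \<subseteq> ball z r \<and> uniform_limit (cball y r') D (\<lambda>z. fd f z e) sequentially"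
        by blast
    qed
    with r show ?thesis by blast
  qed
  then show ?thesis unfolding holo_on_def by (meson centre_in_ball)
qed

section \<open>Polynomial approximation\<close>

lemma polynomials_monomial: "(\<lambda>z. c * (\<Prod>i\<in>UNIV. z $ i ^ \<alpha> i)) \<in> polynomials"
  unfolding polynomials_def by (intro CollectI exI[of _ "{\<alpha>}"] exI[of _ "\<lambda>_. c"]) simp

lemma polynomials_const: "(\<lambda>z. c) \<in> polynomials"
  using polynomials_monomial[of c "\<lambda>_. 0"] by simp

lemma polynomials_add:
  assumes "p \<in> polynomials" "q \<in> polynomials"
  shows "(\<lambda>z. p z + q z) \<in> polynomials"
proof -
  obtain A c where A: "finite A" "p = (\<lambda>z. \<Sum>\<alpha>\<in>A. c \<alpha> * (\<Prod>i\<in>UNIV. z $ i ^ \<alpha> i))"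
    using assms(1) unfolding polynomials_def by blast
  obtain B d where B: "finite B" "q = (\<lambda>z. \<Sum>\<alpha>\<in>B. d \<alpha> * (\<Prod>i\<in>UNIV. z $ i ^ \<alpha> i))"
    using assms(2) unfolding polynomials_def by blast
  define e where "e = (\<lambda>\<alpha>. (if \<alpha> \<in> A then c \<alpha> else 0) + (if \<alpha> \<in> B then d \<alpha> else 0))"
  have "(\<lambda>z. p z + q z) = (\<lambda>z. \<Sum>\<alpha>\<in>A \<union> B. e \<alpha> * (\<Prod>i\<in>UNIV. z $ i ^ \<alpha> i))"
  proof
    fix z :: "complex ^ 'a"
    have "p z = (\<Sum>\<alpha>\<in>A \<union> B. (if \<alpha> \<in> A then c \<alpha> else 0) * (\<Prod>i\<in>UNIV. z $ i ^ \<alpha> i))"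
      unfolding A(2) by (rule sum.mono_neutral_cong_left) (use A B in auto)
    moreover have "q z = (\<Sum>\<alpha>\<in>A \<union> B. (if \<alpha> \<in> B then d \<alpha> else 0) * (\<Prod>i\<in>UNIV. z $ i ^ \<alpha> i))"
      unfolding B(2) by (rule sum.mono_neutral_cong_left) (use A B in auto)
    ultimately show "p z + q z = (\<Sum>\<alpha>\<in>A \<union> B. e \<alpha> * (\<Prod>i\<in>UNIV. z $ i ^ \<alpha> i))"
      by (simp add: e_def distrib_right sum.distrib)
  qed
  moreover have "finite (A \<union> B)" using A B by simp
  ultimately show ?thesis unfolding polynomials_def by blast
qed

lemma polynomials_sum:
  "(\<And>i. i \<in> I \<Longrightarrow> p i \<in> polynomials) \<Longrightarrow> (\<lambda>z. \<Sum>i\<in>I. p i z) \<in> polynomials"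
  by (induction I rule: infinite_finite_induct) (auto intro!: polynomials_const polynomials_add)

text \<open>Scaling, multiplication by a coordinate and dilation are all linear in the polynomial,
  so each needs checking on monomials only.\<close>

lemma polynomials_transform:
  assumes p: "p \<in> polynomials"
    and T: "\<And>c \<alpha>. T (\<lambda>z. c * (\<Prod>i\<in>UNIV. z $ i ^ \<alpha> i)) \<in> polynomials"
    and lin: "\<And>(A :: ('n \<Rightarrow> nat) set) f. T (\<lambda>z. \<Sum>\<alpha>\<in>A. f \<alpha> z) = (\<lambda>z. \<Sum>\<alpha>\<in>A. T (f \<alpha>) z)"
  shows "T (p :: complex ^ 'n \<Rightarrow> complex) \<in> polynomials"
proof -
  obtain A c where A: "p = (\<lambda>z. \<Sum>\<alpha>\<in>A. c \<alpha> * (\<Prod>i\<in>UNIV. z $ i ^ \<alpha> i))"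
    using p unfolding polynomials_def by blast
  show ?thesis unfolding A lin by (intro polynomials_sum T)
qed

lemma polynomials_cmult: "p \<in> polynomials \<Longrightarrow> (\<lambda>z. a * p z) \<in> polynomials"
  by (rule polynomials_transform[where T = "\<lambda>p z. a * p z"])
     (auto simp: sum_distrib_left mult.assoc[symmetric] intro: polynomials_monomial)

lemma polynomials_nth_mult:
  assumes "p \<in> polynomials"
  shows "(\<lambda>z. z $ k * p z) \<in> polynomials"
proof (rule polynomials_transform[OF assms, where T = "\<lambda>p z. z $ k * p z"])
  fix c and \<alpha> :: "'a \<Rightarrow> nat"
  have "z $ k * (c * (\<Prod>i\<in>UNIV. z $ i ^ \<alpha> i)) = c * (\<Prod>i\<in>UNIV. z $ i ^ (\<alpha>(k := Suc (\<alpha> k))) i)"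
    for z :: "complex ^ 'a"
    by (simp add: prod.remove[of UNIV k])
  then show "(\<lambda>z. z $ k * (c * (\<Prod>i\<in>UNIV. z $ i ^ \<alpha> i))) \<in> polynomials"
    by (simp only: polynomials_monomial)
qed (simp add: sum_distrib_left)

lemma polynomials_dilate:
  assumes "p \<in> polynomials"
  shows "(\<lambda>z. p (c *s z)) \<in> polynomials"
proof (rule polynomials_transform[OF assms, where T = "\<lambda>p z. p (c *s z)"])
  fix a and \<alpha> :: "'a \<Rightarrow> nat"
  have "a * (\<Prod>i\<in>UNIV. (c *s z) $ i ^ \<alpha> i) = a * c ^ sum \<alpha> UNIV * (\<Prod>i\<in>UNIV. z $ i ^ \<alpha> i)"
    for z :: "complex ^ 'a"
    by (simp add: power_mult_distrib prod.distrib power_sum)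
  then show "(\<lambda>z. a * (\<Prod>i\<in>UNIV. (c *s z) $ i ^ \<alpha> i)) \<in> polynomials"
    by (simp only: polynomials_monomial)
qed simp

lemma holo_on_power: "holo_on S f \<Longrightarrow> holo_on S (\<lambda>z. f z ^ n)"
  by (induction n) (auto intro: holo_on_const holo_on_mult)

lemma holo_on_prod: "(\<And>i. i \<in> I \<Longrightarrow> holo_on S (f i)) \<Longrightarrow> holo_on S (\<lambda>z. \<Prod>i\<in>I. f i z)"
  by (induction I rule: infinite_finite_induct) (auto intro!: holo_on_const holo_on_mult)

lemma polynomials_holo_on: "p \<in> polynomials \<Longrightarrow> holo_on S p"
  unfolding polynomials_def
  by (auto intro!: holo_on_sum holo_on_cmult holo_on_prod holo_on_power holo_on_nth)

section \<open>Taylor expansion along complex lines through the origin\<close>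

lemma holomorphic_on_ray:
  assumes "holo_on unit_ball f" "(\<lambda>\<zeta>. \<zeta> *s z) ` U \<subseteq> unit_ball"
  shows "(\<lambda>\<zeta>. f (\<zeta> *s z)) holomorphic_on U"
    and "\<zeta> \<in> U \<Longrightarrow> ((\<lambda>\<zeta>. f (\<zeta> *s z)) has_field_derivative fd f (\<zeta> *s z) z) (at \<zeta>)"
proof -
  have d: "((\<lambda>\<zeta>. f (\<zeta> *s z)) has_field_derivative fd f (\<zeta> *s z) z) (at \<zeta>)" if "\<zeta> \<in> U" for \<zeta>
    using holo_on_line[OF assms(1), of 0 \<zeta> z] assms(2) that by auto
  then show "\<zeta> \<in> U \<Longrightarrow> ((\<lambda>\<zeta>. f (\<zeta> *s z)) has_field_derivative fd f (\<zeta> *s z) z) (at \<zeta>)" .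
  show "(\<lambda>\<zeta>. f (\<zeta> *s z)) holomorphic_on U"
    by (rule holomorphic_onI_deriv[OF d])
qed

lemma smult_unit_ball:
  assumes "z \<in> unit_ball" "cmod c \<le> 1"
  shows "c *s z \<in> unit_ball"
proof -
  have "norm (c *s z) \<le> 1 * norm z" unfolding norm_smult_cvec by (intro mult_right_mono assms) simp
  then show ?thesis using assms by simp
qed

lemma fd_expand:
  assumes "holo_on S f" "z \<in> S"
  shows "fd f z v = (\<Sum>k\<in>UNIV. v $ k * fd f z (axis k 1))"
proof -
  have v: "v = (\<Sum>k\<in>UNIV. v $ k *s axis k 1)" by (simp add: basis_expansion)
  show ?thesis
    by (subst v) (simp add: linear_sum[OF linear_fd[OF assms]] fd_smult[OF assms])
qed

lemma higher_deriv_sum_cmult: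
  assumes "open U" "x \<in> U" "\<And>i. i \<in> I \<Longrightarrow> f i holomorphic_on U"
  shows "(deriv ^^ m) (\<lambda>w. \<Sum>i\<in>I. c i * f i w) x = (\<Sum>i\<in>I. c i * (deriv ^^ m) (f i) x)"
  using assms(3)
proof (induction I rule: infinite_finite_induct)
  case (insert j J)
  then show ?case
    using assms(1,2) by (simp add: higher_deriv_add[of _ U] higher_deriv_cmult[of _ U] holomorphic_intros)
qed auto

text \<open>The induction ranges over all holomorphic functions because its step applies the
  hypothesis to the partial derivatives, which are holomorphic by
  \<open>holo_on_directional\<close>.\<close>

lemma taylor_coefficient_polynomial:
  fixes f :: "complex ^ 'n \<Rightarrow> complex"
  assumes "holo_on unit_ball f"
  shows "\<exists>p\<in>polynomials. \<forall>z\<in>unit_ball. (deriv ^^ m) (\<lambda>\<zeta>. f (\<zeta> *s z)) 0 = p z"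
  using assms
proof (induction m arbitrary: f)
  case 0
  then show ?case by (intro bexI[of _ "\<lambda>z. f 0"]) (auto simp: polynomials_const)
next
  case (Suc m)
  define D where "D = (\<lambda>k z. fd f z (axis k 1))"
  have D: "holo_on unit_ball (D k)" for k
    unfolding D_def by (rule holo_on_directional) (use Suc.prems in auto)
  obtain p where p: "\<And>k. p k \<in> polynomials"
      "\<And>k z. z \<in> unit_ball \<Longrightarrow> (deriv ^^ m) (\<lambda>\<zeta>. D k (\<zeta> *s z)) 0 = p k z"
    using Suc.IH[OF D] by metis
  have "(deriv ^^ Suc m) (\<lambda>\<zeta>. f (\<zeta> *s z)) 0 = (\<Sum>k\<in>UNIV. z $ k * p k z)" if z: "z \<in> unit_ball" for z
  proof -
    have U: "(\<lambda>\<zeta>. \<zeta> *s z) ` ball 0 1 \<subseteq> unit_ball" using smult_unit_ball[OF z] by auto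
    note hol = holomorphic_on_ray[OF Suc.prems U]
    have "(deriv ^^ Suc m) (\<lambda>\<zeta>. f (\<zeta> *s z)) 0 = (deriv ^^ m) (deriv (\<lambda>\<zeta>. f (\<zeta> *s z))) 0"
      by (simp only: funpow_Suc_right o_apply)
    also have "\<dots> = (deriv ^^ m) (\<lambda>\<zeta>. \<Sum>k\<in>UNIV. z $ k * D k (\<zeta> *s z)) 0"
    proof (rule higher_deriv_transform_within_open)
      show "deriv (\<lambda>\<zeta>. f (\<zeta> *s z)) holomorphic_on ball 0 1" by (intro holomorphic_deriv hol) auto
      show "(\<lambda>\<zeta>. \<Sum>k\<in>UNIV. z $ k * D k (\<zeta> *s z)) holomorphic_on ball 0 1"
        by (intro holomorphic_intros holomorphic_on_ray[OF D U])
      show "deriv (\<lambda>\<zeta>. f (\<zeta> *s z)) w = (\<Sum>k\<in>UNIV. z $ k * D k (w *s z))" if "w \<in> ball 0 1" for w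
      proof -
        have "w *s z \<in> unit_ball" using U that by blast
        then show ?thesis
          unfolding D_def using DERIV_imp_deriv[OF hol(2)[OF that]] fd_expand[OF Suc.prems] by simp
      qed
    qed auto
    also have "\<dots> = (\<Sum>k\<in>UNIV. z $ k * (deriv ^^ m) (\<lambda>\<zeta>. D k (\<zeta> *s z)) 0)"
      by (rule higher_deriv_sum_cmult[of "ball 0 1"]) (auto intro: holomorphic_on_ray[OF D U])
    finally show ?thesis using p(2)[OF z] by simp
  qed
  then show ?case
    by (intro bexI[of _ "\<lambda>z. \<Sum>k\<in>UNIV. z $ k * p k z"] polynomials_sum polynomials_nth_mult p) auto
qed

text \<open>For |z| \<le> t the map \<zeta> \<mapsto> f(\<zeta>z) is holomorphic on a disc of radius
  1/t > 1, and on |\<zeta>| = s/t its values are bounded by M. So its Taylor coefficients are at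
  most M(t/s)^m uniformly in z, and the series at \<zeta> = 1 converges uniformly to f(z).\<close>

lemma polynomial_approximation:
  fixes f :: "complex ^ 'n \<Rightarrow> complex"
  assumes f: "holo_on unit_ball f" and "r < 1" "0 < \<epsilon>"
  shows "\<exists>p\<in>polynomials. \<forall>z\<in>cball 0 r. cmod (f z - p z) < \<epsilon>"
proof -
  \<comment> \<open>The maximum with 1/2 makes \<open>t\<close> positive whatever \<open>r\<close>
    is, so that division by \<open>t\<close> is possible.\<close>
  define t where "t = max r (1/2)"
  define s where "s = (1 + t) / 2"
  have t: "0 < t" "t < s" "s < 1" using \<open>r < 1\<close> by (auto simp: t_def s_def max_def)
  have "compact (f ` cball 0 s)"
  proof (rule compact_continuous_image)
    have "cball 0 s \<subseteq> (unit_ball :: (complex ^ 'n) set)" using t by auto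
    then show "continuous_on (cball 0 s) f"
      using holo_on_continuous_on[OF f] continuous_on_subset by blast
  qed simp
  then obtain M where M: "\<And>w. w \<in> cball 0 s \<Longrightarrow> cmod (f w) \<le> M"
    using compact_imp_bounded bounded_iff by (metis imageI)
  define a where "a = (\<lambda>m z. (deriv ^^ m) (\<lambda>\<zeta>. f (\<zeta> *s z)) 0 / fact m)"
  have bd: "cmod (a m z) \<le> M * (t / s) ^ m" and sm: "(\<lambda>m. a m z) sums f z" if z: "z \<in> cball 0 t" for m z
  proof -
    have nz: "norm z \<le> t" using z by simp
    have in_s: "norm (\<zeta> *s z) \<le> cmod \<zeta> * t" for \<zeta>
      unfolding norm_smult_cvec by (intro mult_left_mono nz) simp
    have U: "(\<lambda>\<zeta>. \<zeta> *s z) ` ball 0 (1/t) \<subseteq> unit_ball"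
    proof clarify
      fix \<zeta> :: complex assume "\<zeta> \<in> ball 0 (1/t)"
      then have "cmod \<zeta> * t < 1" using t by (simp add: pos_less_divide_eq)
      then show "\<zeta> *s z \<in> unit_ball" using in_s[of \<zeta>] by simp
    qed
    have hol: "(\<lambda>\<zeta>. f (\<zeta> *s z)) holomorphic_on ball 0 (1/t)" by (rule holomorphic_on_ray(1)[OF f U])
    have sub: "cball 0 (s/t) \<subseteq> (ball 0 (1/t) :: complex set)"
    proof
      fix x :: complex assume "x \<in> cball 0 (s/t)"
      moreover have "s/t < 1/t" using t by (simp add: divide_strict_right_mono)
      ultimately show "x \<in> ball 0 (1/t)" by simp
    qed
    have "cmod ((deriv ^^ m) (\<lambda>\<zeta>. f (\<zeta> *s z)) 0) \<le> fact m * M / (s/t) ^ m"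
    proof (rule Cauchy_inequality)
      show "(\<lambda>\<zeta>. f (\<zeta> *s z)) holomorphic_on ball 0 (s/t)"
        using hol sub ball_subset_cball holomorphic_on_subset by (metis order_trans)
      show "continuous_on (cball 0 (s/t)) (\<lambda>\<zeta>. f (\<zeta> *s z))"
        using hol sub holomorphic_on_imp_continuous_on continuous_on_subset by blast
      show "cmod (f (x *s z)) \<le> M" if "cmod (0 - x) = s/t" for x
        using M in_s[of x] that t by simp
    qed (use t in simp)
    then show "cmod (a m z) \<le> M * (t / s) ^ m"
      by (simp add: a_def norm_divide power_divide divide_le_eq mult_ac)
    have "(\<lambda>m. (deriv ^^ m) (\<lambda>\<zeta>. f (\<zeta> *s z)) 0 / fact m * (1 - 0) ^ m) sums f (1 *s z)"
      by (rule holomorphic_power_series[OF hol]) (use t in auto)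
    then show "(\<lambda>m. a m z) sums f z" by (simp add: a_def)
  qed
  have "uniform_limit (cball 0 t) (\<lambda>n z. \<Sum>i<n. a i z) (\<lambda>z. suminf (\<lambda>i. a i z)) sequentially"
    by (rule Weierstrass_m_test[OF bd]) (use t in \<open>auto intro!: summable_mult summable_geometric\<close>)
  from uniform_limitD[OF this \<open>0 < \<epsilon>\<close>]
  obtain N where N: "\<And>z. z \<in> cball 0 t \<Longrightarrow> dist (\<Sum>i<N. a i z) (suminf (\<lambda>i. a i z)) < \<epsilon>"
    unfolding eventually_sequentially by blast
  obtain P where P: "\<And>m. P m \<in> polynomials"
      "\<And>m z. z \<in> unit_ball \<Longrightarrow> (deriv ^^ m) (\<lambda>\<zeta>. f (\<zeta> *s z)) 0 = P m z"
    using taylor_coefficient_polynomial[OF f] by metis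
  show ?thesis
  proof (intro bexI ballI)
    show "(\<lambda>z. \<Sum>i<N. (1 / fact i) * P i z) \<in> polynomials"
      by (intro polynomials_sum polynomials_cmult P)
    fix z :: "complex ^ 'n" assume "z \<in> cball 0 r"
    then have z: "z \<in> cball 0 t" by (auto simp: t_def)
    then have "z \<in> unit_ball" using t by auto
    then have "(\<Sum>i<N. (1 / fact i) * P i z) = (\<Sum>i<N. a i z)" by (simp add: a_def P(2))
    then show "cmod (f z - (\<Sum>i<N. (1 / fact i) * P i z)) < \<epsilon>"
      using N[OF z] sums_unique[OF sm[OF z]] by (simp add: dist_norm norm_minus_commute)
  qed
qed

section \<open>The little Bloch space\<close>

text \<open>The length of \<open>u\<close> in the Bergman metric at \<open>z\<close>, the
  denominator in \<open>Q\<close>. Bounds on \<open>Q\<close> are written as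
  \<open>cmod (fd f z u) \<le> c * bnorm z u\<close>, a real inequality that involves neither
  division nor a supremum and is harmless at \<open>u = 0\<close>.\<close>

definition bnorm :: "complex ^ 'n \<Rightarrow> complex ^ 'n \<Rightarrow> real" where
  "bnorm z u = sqrt (Re (bergman_metric z u u))"

lemma one_minus_norm_square_pos: "norm z < 1 \<Longrightarrow> 0 < 1 - (norm z)\<^sup>2"
  by (simp add: abs_square_less_1)

lemma bnorm_eq:
  "bnorm z u = sqrt ((real CARD('n) + 1) / 2 *
     ((norm u)\<^sup>2 / (1 - (norm z)\<^sup>2) + (cmod (hprod u z) / (1 - (norm z)\<^sup>2))\<^sup>2))"
  if "norm z < 1" for z u :: "complex ^ 'n"
proof -
  have a: "hprod u u = of_real ((norm u)\<^sup>2)"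
    by (simp add: hprod_def norm_vec_def L2_set_def sum_nonneg complex_norm_square[symmetric])
  have "hprod z u = cnj (hprod u z)" by (simp add: hprod_def mult.commute)
  then have b: "hprod u z * hprod z u = of_real ((cmod (hprod u z))\<^sup>2)"
    by (simp only: complex_norm_square)
  define t where "t = 1 - (norm z)\<^sup>2"
  have t: "t > 0" using one_minus_norm_square_pos[OF that] by (simp add: t_def)
  have "bergman_metric z u u = of_real ((real CARD('n) + 1) / 2 *
      (t * (norm u)\<^sup>2 + (cmod (hprod u z))\<^sup>2) / t\<^sup>2)"
    unfolding bergman_metric_def a b by (simp add: t_def)
  also have "(real CARD('n) + 1) / 2 * (t * (norm u)\<^sup>2 + (cmod (hprod u z))\<^sup>2) / t\<^sup>2 =
      (real CARD('n) + 1) / 2 * ((norm u)\<^sup>2 / t + (cmod (hprod u z) / t)\<^sup>2)"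
    using t by (simp add: power_divide field_simps power2_eq_square)
  finally show ?thesis unfolding bnorm_def t_def by (simp only: Re_complex_of_real)
qed

text \<open>Since (n+1)/2 \<ge> 1, the term |u|^2/(1 - |z|^2) of the squared Bergman length already
  suffices. The factor \<open>sqrt (1 - (norm z)\<^sup>2)\<close> is what makes bounded derivatives
  negligible near the sphere.\<close>

lemma norm_le_bnorm:
  fixes z u :: "complex ^ 'n"
  assumes "norm z < 1"
  shows "norm u \<le> sqrt (1 - (norm z)\<^sup>2) * bnorm z u"
proof -
  define t where "t = 1 - (norm z)\<^sup>2"
  have t: "t > 0" using one_minus_norm_square_pos[OF assms] by (simp add: t_def)
  have c: "1 \<le> (real CARD('n) + 1) / 2"
    using zero_less_card_finite[where 'a = 'n] by simp
  have "(norm u)\<^sup>2 / t \<le> 1 * ((norm u)\<^sup>2 / t + (cmod (hprod u z) / t)\<^sup>2)" by simp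
  also have "\<dots> \<le> (real CARD('n) + 1) / 2 * ((norm u)\<^sup>2 / t + (cmod (hprod u z) / t)\<^sup>2)"
    using t by (intro mult_right_mono c) auto
  finally have "(norm u)\<^sup>2 \<le> t * ((real CARD('n) + 1) / 2 * ((norm u)\<^sup>2 / t + (cmod (hprod u z) / t)\<^sup>2))"
    using t by (simp only: pos_divide_le_eq mult.commute)
  then have "norm u \<le> sqrt (t * ((real CARD('n) + 1) / 2 * ((norm u)\<^sup>2 / t + (cmod (hprod u z) / t)\<^sup>2)))"
    by (rule real_le_rsqrt)
  then show ?thesis by (simp only: real_sqrt_mult bnorm_eq[OF assms] t_def)
qed

lemma bnorm_nonneg: "norm z < 1 \<Longrightarrow> 0 \<le> bnorm z u"
  unfolding bnorm_eq using one_minus_norm_square_pos[of z] by simp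

lemma norm_le_bnorm': "norm u \<le> bnorm z u" if "norm z < 1"
proof -
  have "sqrt (1 - (norm z)\<^sup>2) * bnorm z u \<le> 1 * bnorm z u"
    by (intro mult_right_mono bnorm_nonneg that) simp
  then show ?thesis using norm_le_bnorm[OF that, of u] by simp
qed

lemma bnorm_pos: "norm z < 1 \<Longrightarrow> u \<noteq> 0 \<Longrightarrow> 0 < bnorm z u"
  using norm_le_bnorm'[of z u] by (smt (verit) zero_less_norm_iff)

text \<open>An elementary instance of Schwarz-Pick: z \<mapsto> rz contracts the Bergman metric,
  because both terms in \<open>bnorm_eq\<close> have smaller numerators and a larger denominator.
  Hence the Bloch quotient of f(rz) at z is at most that of f at rz.\<close>

lemma bnorm_dilate:
  assumes z: "norm z < 1" and r: "0 \<le> r" "r \<le> 1"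
  shows "bnorm (r *\<^sub>R z) (r *\<^sub>R u) \<le> bnorm z u"
proof -
  have nz: "norm (r *\<^sub>R z) < 1"
  proof -
    have "norm (r *\<^sub>R z) \<le> 1 * norm z" using r by (simp add: mult_left_le_one_le)
    then show ?thesis using z by simp
  qed
  define t where "t = 1 - (norm z)\<^sup>2"
  define s where "s = 1 - (norm (r *\<^sub>R z))\<^sup>2"
  have t: "t > 0" using one_minus_norm_square_pos[OF z] by (simp add: t_def)
  have ts: "t \<le> s"
    unfolding t_def s_def using r by (simp add: power_mult_distrib mult_left_le_one_le power_le_one)
  have h: "hprod (r *\<^sub>R u) (r *\<^sub>R z) = of_real (r\<^sup>2) * hprod u z"
    by (simp add: hprod_def sum_distrib_left power2_eq_square scaleR_conv_of_real[where 'a = complex] mult_ac)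
  have 1: "(norm (r *\<^sub>R u))\<^sup>2 / s \<le> (norm u)\<^sup>2 / t"
  proof (rule frac_le)
    show "(norm (r *\<^sub>R u))\<^sup>2 \<le> (norm u)\<^sup>2"
      using r by (simp add: power_mult_distrib mult_left_le_one_le power_le_one)
  qed (use t ts in auto)
  have 2: "cmod (hprod (r *\<^sub>R u) (r *\<^sub>R z)) / s \<le> cmod (hprod u z) / t"
  proof (rule frac_le)
    show "cmod (hprod (r *\<^sub>R u) (r *\<^sub>R z)) \<le> cmod (hprod u z)"
      unfolding h norm_mult using r by (simp add: norm_power mult_left_le_one_le power_le_one)
  qed (use t ts in auto)
  have 3: "(cmod (hprod (r *\<^sub>R u) (r *\<^sub>R z)) / s)\<^sup>2 \<le> (cmod (hprod u z) / t)\<^sup>2"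
    by (rule power_mono[OF 2]) (use t ts in auto)
  show ?thesis
    unfolding bnorm_eq[OF z] bnorm_eq[OF nz] t_def[symmetric] s_def[symmetric]
    by (intro real_sqrt_le_mono mult_left_mono add_mono 1 3) simp
qed

section \<open>Bloch quotients as inequalities for the derivative\<close>

lemma partial_deriv_eq_fd:
  assumes "holo_on S f" "z \<in> S"
  shows "partial_deriv k f z = fd f z (axis k 1)"
proof -
  have e: "(\<chi> j. if j = k then w else z $ j) = z + (w - z $ k) *s axis k 1" for w
    by (simp add: vec_eq_iff axis_def)
  have "((\<lambda>\<zeta>. f (z + \<zeta> *s axis k 1)) has_field_derivative fd f z (axis k 1)) (at (z $ k - z $ k))"
    using holo_on_line[OF assms(1), of z 0 "axis k 1"] assms(2) by simp
  moreover have "((\<lambda>w. w - z $ k) has_field_derivative 1) (at (z $ k))"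
    by (auto intro!: derivative_eq_intros)
  ultimately have "((\<lambda>w. f (z + (w - z $ k) *s axis k 1)) has_field_derivative fd f z (axis k 1) * 1) (at (z $ k))"
    by (rule DERIV_chain2)
  then show ?thesis unfolding partial_deriv_def e by (simp add: DERIV_imp_deriv)
qed

text \<open>The factor \<open>a\<close> is carried along so that the weight |\<psi>(z)| can later be
  placed in front of the supremum that defines \<theta>.\<close>

lemma Q_le_iff:
  assumes f: "holo_on unit_ball f" and z: "z \<in> unit_ball" and "0 \<le> a" "0 \<le> c"
  shows "ennreal a * Q f z \<le> ennreal c \<longleftrightarrow> (\<forall>u. a * cmod (fd f z u) \<le> c * bnorm z u)"
proof -
  have s: "(\<Sum>k\<in>UNIV. partial_deriv k f z * u $ k) = fd f z u" for u
    unfolding fd_expand[OF f z, of u] partial_deriv_eq_fd[OF f z] by (simp add: mult.commute)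
  have "ennreal a * Q f z \<le> ennreal c \<longleftrightarrow>
      (\<forall>u\<in>UNIV - {0}. ennreal a * ennreal (cmod (fd f z u) / bnorm z u) \<le> ennreal c)"
    unfolding Q_def s bnorm_def[symmetric] SUP_mult_left_ennreal by (simp add: SUP_le_iff)
  also have "\<dots> \<longleftrightarrow> (\<forall>u\<in>UNIV - {0}. a * cmod (fd f z u) \<le> c * bnorm z u)"
  proof (intro ball_cong refl)
    fix u :: "complex ^ 'a" assume "u \<in> UNIV - {0}"
    then have "bnorm z u > 0" using bnorm_pos z by simp
    then show "ennreal a * ennreal (cmod (fd f z u) / bnorm z u) \<le> ennreal c \<longleftrightarrow>
        a * cmod (fd f z u) \<le> c * bnorm z u"
      using assms(3,4) by (simp add: ennreal_mult[symmetric] divide_le_eq)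
  qed
  also have "\<dots> \<longleftrightarrow> (\<forall>u. a * cmod (fd f z u) \<le> c * bnorm z u)"
    using fd_zero[OF f z] bnorm_nonneg[of z 0] z \<open>0 \<le> c\<close> by auto
  finally show ?thesis .
qed

lemma bloch_seminorm_le_iff:
  assumes "holo_on unit_ball f" "0 \<le> c"
  shows "bloch_seminorm f \<le> ennreal c \<longleftrightarrow> (\<forall>z\<in>unit_ball. \<forall>u. cmod (fd f z u) \<le> c * bnorm z u)"
  using Q_le_iff[OF assms(1) _ zero_le_one assms(2)] by (simp add: bloch_seminorm_def SUP_le_iff)

lemma blochI:
  assumes "holo_on unit_ball f" "0 \<le> c" "\<And>z u. z \<in> unit_ball \<Longrightarrow> cmod (fd f z u) \<le> c * bnorm z u"
  shows "f \<in> bloch" "bloch_norm f \<le> cmod (f 0) + c"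
proof -
  have le: "bloch_seminorm f \<le> ennreal c" using bloch_seminorm_le_iff[OF assms(1,2)] assms(3) by blast
  then have "bloch_seminorm f < \<infinity>" using ennreal_less_top le_less_trans by fastforce
  then show "f \<in> bloch" using assms(1) by (simp add: bloch_def holo_on_ball_eq)
  have "enn2real (bloch_seminorm f) \<le> c" using enn2real_leI[OF assms(2) le] .
  then show "bloch_norm f \<le> cmod (f 0) + c" by (simp add: bloch_norm_def)
qed

lemma blochD:
  assumes "f \<in> bloch"
  shows "holo_on unit_ball f" "0 \<le> bloch_norm f"
    "z \<in> unit_ball \<Longrightarrow> cmod (fd f z u) \<le> bloch_norm f * bnorm z u"
proof -
  show h: "holo_on unit_ball f" using assms by (simp add: bloch_def holo_on_ball_eq)
  show "0 \<le> bloch_norm f" by (simp add: bloch_norm_def)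
  show "cmod (fd f z u) \<le> bloch_norm f * bnorm z u" if z: "z \<in> unit_ball"
  proof -
    \<comment> \<open>Finiteness enters here: \<open>enn2real\<close> sends infinity to 0, so for a
      function outside the Bloch space this bound would be false.\<close>
    have "bloch_seminorm f \<le> ennreal (enn2real (bloch_seminorm f))" using assms by (simp add: bloch_def)
    then have "cmod (fd f z u) \<le> enn2real (bloch_seminorm f) * bnorm z u"
      using bloch_seminorm_le_iff[OF h, of "enn2real (bloch_seminorm f)"] z by simp
    also have "\<dots> \<le> bloch_norm f * bnorm z u"
      using z by (intro mult_right_mono bnorm_nonneg) (auto simp: bloch_norm_def)
    finally show ?thesis .
  qed
qed

text \<open>Cauchy's estimate on balls of radius (1 - \<rho>)/2, which reach at most to norm (1 +
  \<rho>)/2. It covers the region away from the sphere in all later arguments.\<close>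

lemma fd_interior_bound:
  assumes f: "holo_on unit_ball f" and \<rho>: "0 \<le> \<rho>" "\<rho> < 1" and z: "norm z \<le> \<rho>"
    and M: "\<And>w. norm w \<le> (1 + \<rho>) / 2 \<Longrightarrow> cmod (f w) \<le> M"
  shows "cmod (fd f z u) \<le> 2 * M / (1 - \<rho>) * norm u"
    and "cmod (fd f z u) \<le> 2 * M / (1 - \<rho>) * bnorm z u"
proof -
  have n: "norm w \<le> (1 + \<rho>) / 2" if "w \<in> cball z ((1 - \<rho>) / 2)" for w
  proof -
    have "norm w \<le> norm z + dist z w" by (metis dist_norm norm_minus_commute norm_triangle_sub)
    then have "norm w \<le> \<rho> + (1 - \<rho>) / 2" using that z by (simp only: mem_cball)
    then show ?thesis by (simp add: field_simps)
  qed
  have "cmod (fd f z u) \<le> M / ((1 - \<rho>) / 2) * norm u"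
  proof (rule fd_bound[OF f])
    show "cball z ((1 - \<rho>) / 2) \<subseteq> unit_ball"
    proof
      fix w assume "w \<in> cball z ((1 - \<rho>) / 2)"
      from n[OF this] show "w \<in> unit_ball" using \<rho> by simp
    qed
    show "cmod (f w) \<le> M" if "w \<in> cball z ((1 - \<rho>) / 2)" for w
      using M n[OF that] by blast
  qed (use \<rho> in simp)
  then show b: "cmod (fd f z u) \<le> 2 * M / (1 - \<rho>) * norm u" by (simp add: mult.commute)
  have "0 \<le> M" using order_trans[OF norm_ge_zero M[of 0]] \<rho> by simp
  then have "2 * M / (1 - \<rho>) * norm u \<le> 2 * M / (1 - \<rho>) * bnorm z u"
    using \<rho> z by (intro mult_left_mono norm_le_bnorm') auto
  with b show "cmod (fd f z u) \<le> 2 * M / (1 - \<rho>) * bnorm z u" by simp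
qed

lemma holo_on_bounded_interior:
  assumes "holo_on unit_ball f" "\<rho> < 1"
  obtains M where "0 \<le> M" "\<And>w. norm w \<le> \<rho> \<Longrightarrow> cmod (f w) \<le> M"
proof -
  have sub: "cball 0 \<rho> \<subseteq> (unit_ball :: (complex ^ 'a) set)" using assms(2) by auto
  have "compact (f ` cball 0 \<rho>)"
    by (rule compact_continuous_image[OF continuous_on_subset[OF holo_on_continuous_on[OF assms(1)] sub] compact_cball])
  then obtain M where M: "\<And>w. w \<in> cball 0 \<rho> \<Longrightarrow> cmod (f w) \<le> M"
    using compact_imp_bounded bounded_iff by (metis imageI)
  show thesis
  proof
    show "0 \<le> max 0 M" by simp
    show "cmod (f w) \<le> max 0 M" if "norm w \<le> \<rho>" for w
      using M[of w] that by simp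
  qed
qed

section \<open>Closure of the polynomials versus vanishing at the sphere\<close>

definition vanishes_at_sphere :: "(complex ^ 'n \<Rightarrow> complex) \<Rightarrow> bool" where
  "vanishes_at_sphere f \<longleftrightarrow>
     (\<forall>\<epsilon>>0. \<exists>\<rho><1. \<forall>z. \<rho> < norm z \<and> norm z < 1 \<longrightarrow> (\<forall>u. cmod (fd f z u) \<le> \<epsilon> * bnorm z u))"

text \<open>The derivative of a polynomial is bounded on the ball in the Euclidean norm, and the
  Euclidean norm is \<open>o(bnorm)\<close> at the sphere by \<open>norm_le_bnorm\<close>.\<close>

lemma polynomials_vanish:
  fixes p :: "complex ^ 'n \<Rightarrow> complex"
  assumes "p \<in> polynomials"
  shows "p \<in> bloch" "vanishes_at_sphere p"
proof -
  have p: "holo_on UNIV p" using polynomials_holo_on[OF assms] .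
  have "compact (p ` cball 0 2)"
    by (rule compact_continuous_image[OF continuous_on_subset[OF holo_on_continuous_on[OF p]] compact_cball]) simp
  then obtain M where M: "\<And>w. w \<in> cball 0 2 \<Longrightarrow> cmod (p w) \<le> M"
    using compact_imp_bounded bounded_iff by (metis imageI)
  have M0: "0 \<le> M" using order_trans[OF norm_ge_zero M[of 0]] by simp
  have bd: "cmod (fd p z u) \<le> M * norm u" if "norm z < 1" for z u
  proof -
    have "cmod (fd p z u) \<le> M / 1 * norm u"
    proof (rule fd_bound[OF p])
      fix w assume "w \<in> cball z 1"
      then have "norm w \<le> norm z + 1"
        using norm_triangle_sub[of w z] by (simp add: dist_norm norm_minus_commute)
      then show "cmod (p w) \<le> M" using M[of w] that by simp
    qed auto
    then show ?thesis by simp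
  qed
  show "p \<in> bloch"
  proof (rule blochI(1)[OF polynomials_holo_on[OF assms] M0])
    fix z u :: "complex ^ 'n" assume "z \<in> unit_ball"
    then show "cmod (fd p z u) \<le> M * bnorm z u"
      using bd[of z u] mult_left_mono[OF norm_le_bnorm' M0, of z u] by simp
  qed
  show "vanishes_at_sphere p" unfolding vanishes_at_sphere_def
  proof (intro allI impI)
    fix \<epsilon> :: real assume \<epsilon>: "\<epsilon> > 0"
    \<comment> \<open>The radius below comes from 1 - |z|^2 \<le> 2(1 - |z|) < \<delta>^2; the
      summand 1 covers M = 0.\<close>
    define \<delta> where "\<delta> = \<epsilon> / (M + 1)"
    have \<delta>: "\<delta> > 0" "M * \<delta> \<le> \<epsilon>"
      using \<epsilon> M0 by (auto simp: \<delta>_def divide_le_eq mult_left_mono)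
    show "\<exists>\<rho><1. \<forall>z. \<rho> < norm z \<and> norm z < 1 \<longrightarrow> (\<forall>u. cmod (fd p z u) \<le> \<epsilon> * bnorm z u)"
    proof (intro exI[of _ "1 - \<delta>\<^sup>2 / 2"] conjI allI impI)
      fix z u :: "complex ^ 'n" assume z: "1 - \<delta>\<^sup>2 / 2 < norm z \<and> norm z < 1"
      have "1 - (norm z)\<^sup>2 = (1 - norm z) * (1 + norm z)" by (simp add: power2_eq_square algebra_simps)
      also have "\<dots> \<le> (\<delta>\<^sup>2 / 2) * 2" using z by (intro mult_mono) auto
      finally have "sqrt (1 - (norm z)\<^sup>2) \<le> \<delta>" using \<delta> real_le_lsqrt by simp
      then have "sqrt (1 - (norm z)\<^sup>2) * bnorm z u \<le> \<delta> * bnorm z u"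
        using z by (intro mult_right_mono bnorm_nonneg) auto
      then have "norm u \<le> \<delta> * bnorm z u" using norm_le_bnorm[of z u] z by simp
      then have "M * norm u \<le> M * \<delta> * bnorm z u" using mult_left_mono M0 by (simp add: mult.assoc)
      also have "\<dots> \<le> \<epsilon> * bnorm z u" using z by (intro mult_right_mono bnorm_nonneg \<delta>) auto
      finally show "cmod (fd p z u) \<le> \<epsilon> * bnorm z u" using bd[of z u] z by simp
    qed (use \<delta> in simp)
  qed
qed

lemma little_bloch_imp_vanishes:
  fixes f :: "complex ^ 'n \<Rightarrow> complex"
  assumes "f \<in> little_bloch"
  shows "vanishes_at_sphere f"
  unfolding vanishes_at_sphere_def
proof (intro allI impI)
  fix \<epsilon> :: real assume \<epsilon>: "\<epsilon> > 0"
  have fb: "f \<in> bloch" using assms by (simp add: little_bloch_def)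
  obtain p where p: "p \<in> polynomials" "p \<in> bloch" "bloch_norm (\<lambda>z. f z - p z) < \<epsilon> / 2"
    using assms \<epsilon> unfolding little_bloch_def by (auto dest!: spec[of _ "\<epsilon> / 2"])
  note hf = blochD(1)[OF fb] and hp = blochD(1)[OF p(2)]
  \<comment> \<open>Needed before the small \<open>bloch_norm\<close> of the difference says
    anything about its derivative, since an infinite seminorm would be read as 0.\<close>
  have d: "(\<lambda>z. f z - p z) \<in> bloch"
  proof (rule blochI(1)[OF holo_on_diff[OF hf hp]])
    show "0 \<le> bloch_norm f + bloch_norm p" using blochD(2)[OF fb] blochD(2)[OF p(2)] by simp
    fix z u :: "complex ^ 'n" assume z: "z \<in> unit_ball"
    show "cmod (fd (\<lambda>z. f z - p z) z u) \<le> (bloch_norm f + bloch_norm p) * bnorm z u"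
      unfolding fd_diff[OF hf hp z] distrib_right
      by (rule order_trans[OF norm_triangle_ineq4 add_mono[OF blochD(3)[OF fb z] blochD(3)[OF p(2) z]]])
  qed
  obtain \<rho> where \<rho>: "\<rho> < 1"
    "\<And>z u. \<rho> < norm z \<Longrightarrow> norm z < 1 \<Longrightarrow> cmod (fd p z u) \<le> \<epsilon> / 2 * bnorm z u"
    using polynomials_vanish(2)[OF p(1)] \<epsilon> unfolding vanishes_at_sphere_def by (meson half_gt_zero)
  show "\<exists>\<rho><1. \<forall>z. \<rho> < norm z \<and> norm z < 1 \<longrightarrow> (\<forall>u. cmod (fd f z u) \<le> \<epsilon> * bnorm z u)"
  proof (intro exI[of _ \<rho>] conjI allI impI \<rho>)
    fix z u :: "complex ^ 'n" assume z: "\<rho> < norm z \<and> norm z < 1"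
    then have zb: "z \<in> unit_ball" by simp
    have "cmod (fd (\<lambda>z. f z - p z) z u) \<le> \<epsilon> / 2 * bnorm z u"
      by (rule order_trans[OF blochD(3)[OF d zb] mult_right_mono]) (use p(3) z bnorm_nonneg in auto)
    then have "cmod (fd f z u - fd p z u) \<le> \<epsilon> / 2 * bnorm z u" unfolding fd_diff[OF hf hp zb] .
    moreover have "cmod (fd p z u) \<le> \<epsilon> / 2 * bnorm z u" using \<rho> z by blast
    ultimately have "cmod (fd f z u) \<le> \<epsilon> / 2 * bnorm z u + \<epsilon> / 2 * bnorm z u"
      using norm_triangle_sub[of "fd f z u" "fd p z u"] by linarith
    then show "cmod (fd f z u) \<le> \<epsilon> * bnorm z u" by (simp add: field_simps)
  qed
qed

lemma
  assumes f: "holo_on unit_ball f" and r: "0 \<le> r" "r \<le> 1"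
  shows holo_on_dilate: "holo_on unit_ball (\<lambda>z. f (of_real r *s z))"
    and fd_dilate: "z \<in> unit_ball \<Longrightarrow> fd (\<lambda>z. f (of_real r *s z)) z u = fd f (r *\<^sub>R z) (r *\<^sub>R u)"
proof -
  have c: "holo_on unit_ball (\<lambda>z. (of_real r *s z) $ i)" for i
    by (simp add: holo_on_cmult holo_on_nth)
  have i: "(\<lambda>z. of_real r *s z) ` unit_ball \<subseteq> unit_ball" using smult_unit_ball r by force
  show "holo_on unit_ball (\<lambda>z. f (of_real r *s z))" using holo_on_compose[OF c i f] by (simp add: o_def)
  assume z: "z \<in> unit_ball"
  have "fd (\<lambda>z. (of_real r *s z) $ i) z u = of_real r * u $ i" for i
    using fd_cmult[OF holo_on_nth z, of "of_real r" i u] by (simp add: fd_nth)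
  then have "(\<chi> i. fd (\<lambda>z. (of_real r *s z) $ i) z u) = r *\<^sub>R u"
    by (simp add: vec_eq_iff scaleR_conv_of_real[where 'a = complex])
  then show "fd (\<lambda>z. f (of_real r *s z)) z u = fd f (r *\<^sub>R z) (r *\<^sub>R u)"
    using fd_compose[OF c i f z, of u] by (simp add: o_def of_real_smult_cvec)
qed

lemma vanishes_imp_bloch:
  fixes f :: "complex ^ 'n \<Rightarrow> complex"
  assumes f: "holo_on unit_ball f" and van: "vanishes_at_sphere f"
  shows "f \<in> bloch"
proof -
  obtain \<rho>0 where \<rho>0: "\<rho>0 < 1"
    "\<And>z u. \<rho>0 < norm z \<Longrightarrow> norm z < 1 \<Longrightarrow> cmod (fd f z u) \<le> 1 * bnorm z u"
    using van unfolding vanishes_at_sphere_def by (meson zero_less_one)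
  define \<rho> where "\<rho> = max 0 \<rho>0"
  have \<rho>: "0 \<le> \<rho>" "\<rho> < 1" using \<rho>0 by (auto simp: \<rho>_def)
  then have "(1 + \<rho>) / 2 < 1" by simp
  from holo_on_bounded_interior[OF f this]
  obtain M where M: "0 \<le> M" "\<And>w. norm w \<le> (1 + \<rho>) / 2 \<Longrightarrow> cmod (f w) \<le> M" by blast
  show "f \<in> bloch"
  proof (rule blochI(1)[OF f])
    show "0 \<le> max 1 (2 * M / (1 - \<rho>))" by simp
    fix z u :: "complex ^ 'n" assume z: "z \<in> unit_ball"
    have "\<exists>c. c \<le> max 1 (2 * M / (1 - \<rho>)) \<and> cmod (fd f z u) \<le> c * bnorm z u"
    proof (cases "norm z \<le> \<rho>")
      case True
      show ?thesis
        by (rule exI, rule conjI[OF _ fd_interior_bound(2)[OF f \<rho> True M(2)]]) auto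
    next
      case False
      then show ?thesis using \<rho>0(2)[of z u] z by (intro exI[of _ 1]) (simp add: \<rho>_def)
    qed
    then show "cmod (fd f z u) \<le> max 1 (2 * M / (1 - \<rho>)) * bnorm z u"
      using z by (auto intro: order_trans mult_right_mono bnorm_nonneg)
  qed
qed

text \<open>Polynomials approximate \<open>f\<close> uniformly only on smaller balls, which gives no
  control of derivatives up to the sphere. The way out is to compare \<open>f\<close> with its
  dilate f(rz), and f(rz) with P(rz) for a polynomial P close to \<open>f\<close> on a ball of
  radius between r and 1.\<close>

lemma vanishes_imp_little_bloch:
  fixes f :: "complex ^ 'n \<Rightarrow> complex"
  assumes f: "holo_on unit_ball f" and van: "vanishes_at_sphere f"
  shows "f \<in> little_bloch"
proof -
  have "\<exists>p\<in>polynomials \<inter> bloch. bloch_norm (\<lambda>z. f z - p z) < \<epsilon>" if \<epsilon>: "\<epsilon> > 0" for \<epsilon>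
  proof -
    \<comment> \<open>The final bound is \<open>4 * e\<close>: the value at 0 costs
      \<open>e\<close>, the passage to the dilate \<open>2 * e\<close>, and the polynomial
      \<open>e\<close>.\<close>
    define e where "e = \<epsilon> / 8"
    have e: "e > 0" using \<epsilon> by (simp add: e_def)
    obtain \<rho>0 where \<rho>0: "\<rho>0 < 1"
      "\<And>z u. \<rho>0 < norm z \<Longrightarrow> norm z < 1 \<Longrightarrow> cmod (fd f z u) \<le> e * bnorm z u"
      using van e unfolding vanishes_at_sphere_def by meson
    define \<rho> where "\<rho> = max 0 \<rho>0"
    have \<rho>: "0 \<le> \<rho>" "\<rho> < 1" using \<rho>0 by (auto simp: \<rho>_def)
    have near: "cmod (fd f z u) \<le> e * bnorm z u" if "\<rho> < norm z" "norm z < 1" for z u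
      using \<rho>0(2)[of z u] that by (simp add: \<rho>_def)
    define \<sigma> where "\<sigma> = (1 + \<rho>) / 2"
    have \<sigma>: "0 < \<sigma>" "\<sigma> < 1" "\<rho> < \<sigma>" using \<rho> by (auto simp: \<sigma>_def)
    have sub: "cball 0 ((1 + \<sigma>) / 2) \<subseteq> (unit_ball :: (complex ^ 'n) set)" using \<sigma> by auto
    have "uniformly_continuous_on (cball 0 ((1 + \<sigma>) / 2)) f"
      by (rule compact_uniformly_continuous[OF continuous_on_subset[OF holo_on_continuous_on[OF f] sub] compact_cball])
    moreover have "0 < e * (1 - \<sigma>) / 2" using e \<sigma> by simp
    ultimately obtain d where d: "d > 0" and "\<forall>x\<in>cball 0 ((1 + \<sigma>) / 2). \<forall>y\<in>cball 0 ((1 + \<sigma>) / 2).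
        dist y x < d \<longrightarrow> dist (f y) (f x) < e * (1 - \<sigma>) / 2"
      unfolding uniformly_continuous_on_def by blast
    then have uc: "dist (f x) (f y) < e * (1 - \<sigma>) / 2"
      if "norm x \<le> (1 + \<sigma>) / 2" "norm y \<le> (1 + \<sigma>) / 2" "dist x y < d" for x y
      using that by simp
    \<comment> \<open>Two demands on \<open>r\<close>: \<open>1 - r < d\<close> for uniform
      continuity, and \<open>r > q\<close>, that is \<open>r * \<sigma> > \<rho>\<close>, so that
      points of norm above \<sigma> stay in the region where the quotient of \<open>f\<close> is
      small after dilation.\<close>
    define q where "q = \<rho> / \<sigma>"
    define r where "r = max (1 - d / 2) ((1 + q) / 2)"
    have q: "q < 1" "0 \<le> q" using \<rho> \<sigma> by (auto simp: q_def)
    have r: "0 < r" "r < 1" "1 - r < d" "q < r"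
    proof -
      have "1 - d / 2 \<le> r" "(1 + q) / 2 \<le> r" "r < 1" using q d by (auto simp: r_def)
      then show "0 < r" "r < 1" "1 - r < d" "q < r" using q d by simp_all
    qed
    have r\<sigma>: "\<rho> < r * \<sigma>" using r(4) \<sigma> by (simp add: q_def divide_less_eq)
    define s where "s = (1 + r) / 2"
    \<comment> \<open>The tolerance \<open>e * (1 - r) / 2\<close> is chosen to cancel the constant
      2/(1 - r) of the interior estimate at radius \<open>r\<close>; likewise
      \<open>e * (1 - \<sigma>) / 2\<close> above.\<close>
    have "s < 1" "0 < e * (1 - r) / 2" using r e by (auto simp: s_def)
    from polynomial_approximation[OF f this]
    obtain P where P: "P \<in> polynomials" "\<And>z. norm z \<le> s \<Longrightarrow> cmod (f z - P z) < e * (1 - r) / 2"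
      by auto
    have hP: "holo_on unit_ball P" by (rule polynomials_holo_on[OF P(1)])
    define g where "g = (\<lambda>z. f (of_real r *s z))"
    define p where "p = (\<lambda>z. P (of_real r *s z))"
    have r': "0 \<le> r" "r \<le> 1" using r by auto
    have hg: "holo_on unit_ball g" unfolding g_def by (rule holo_on_dilate[OF f r'])
    have pp: "p \<in> polynomials" unfolding p_def by (rule polynomials_dilate[OF P(1)])
    have hp: "holo_on unit_ball p" by (rule polynomials_holo_on[OF pp])
    have 1: "cmod (fd g z u - fd p z u) \<le> e * bnorm z u" if z: "z \<in> unit_ball" for z u
    proof -
      have nz: "norm (r *\<^sub>R z) \<le> r" using z r by (simp add: mult_left_le)
      have rz: "r *\<^sub>R z \<in> unit_ball" using le_less_trans[OF nz r(2)] by simp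
      have "fd g z u - fd p z u = fd (\<lambda>z. f z - P z) (r *\<^sub>R z) (r *\<^sub>R u)"
        unfolding g_def p_def fd_dilate[OF f r' z] fd_dilate[OF hP r' z] fd_diff[OF f hP rz] ..
      moreover have "cmod (fd (\<lambda>z. f z - P z) (r *\<^sub>R z) (r *\<^sub>R u)) \<le>
          2 * (e * (1 - r) / 2) / (1 - r) * norm (r *\<^sub>R u)"
        by (rule fd_interior_bound(1)[OF holo_on_diff[OF f hP] r'(1) r(2) nz])
           (use P(2) in \<open>auto simp: s_def intro: less_imp_le\<close>)
      ultimately have "cmod (fd g z u - fd p z u) \<le> e * norm (r *\<^sub>R u)" using r by simp
      also have "\<dots> \<le> e * bnorm z u"
      proof (intro mult_left_mono)
        show "norm (r *\<^sub>R u) \<le> bnorm z u"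
          using norm_le_bnorm'[of z u] z r mult_right_mono[OF r'(2), of "norm u"] by simp
      qed (use e in simp)
      finally show ?thesis .
    qed
    \<comment> \<open>Inside radius \<sigma> the difference is small by uniform continuity and
      Cauchy; outside, both derivatives are small separately.\<close>
    have 2: "cmod (fd f z u - fd g z u) \<le> 2 * e * bnorm z u" if z: "z \<in> unit_ball" for z u
    proof (cases "norm z \<le> \<sigma>")
      case True
      have "cmod (fd (\<lambda>z. f z - g z) z u) \<le> 2 * (e * (1 - \<sigma>) / 2) / (1 - \<sigma>) * bnorm z u"
      proof (rule fd_interior_bound(2)[OF holo_on_diff[OF f hg] _ \<sigma>(2) True])
        fix w :: "complex ^ 'n" assume w: "norm w \<le> (1 + \<sigma>) / 2"
        have w1: "norm w \<le> 1" using w \<sigma> by simp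
        have "norm (r *\<^sub>R w) \<le> 1 * norm w" using mult_right_mono[OF r'(2), of "norm w"] r by simp
        moreover have "dist w (r *\<^sub>R w) < d"
        proof -
          have "w - r *\<^sub>R w = (1 - r) *\<^sub>R w" by (simp add: algebra_simps)
          then have "dist w (r *\<^sub>R w) = (1 - r) * norm w" using r by (simp add: dist_norm)
          also have "\<dots> \<le> 1 - r" using w1 r by (simp add: mult_left_le)
          finally show ?thesis using r by simp
        qed
        ultimately have "dist (f w) (f (r *\<^sub>R w)) < e * (1 - \<sigma>) / 2" using uc w by simp
        then show "cmod (f w - g w) \<le> e * (1 - \<sigma>) / 2"
          by (simp add: g_def of_real_smult_cvec dist_norm)
      qed (use \<sigma> in simp)
      then have "cmod (fd f z u - fd g z u) \<le> e * bnorm z u"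
        unfolding fd_diff[OF f hg z] using \<sigma> by simp
      moreover have "0 \<le> e * bnorm z u" using e bnorm_nonneg[of z u] z by simp
      ultimately show ?thesis by simp
    next
      case False
      have "\<rho> < r * \<sigma>" by (rule r\<sigma>)
      also have "\<dots> \<le> norm (r *\<^sub>R z)" using False r by simp
      finally have 3: "\<rho> < norm (r *\<^sub>R z)" .
      have "norm (r *\<^sub>R z) \<le> 1 * norm z" using mult_right_mono[OF r'(2), of "norm z"] r by simp
      then have "norm (r *\<^sub>R z) < 1" using z by simp
      from near[OF 3 this] have "cmod (fd g z u) \<le> e * bnorm (r *\<^sub>R z) (r *\<^sub>R u)"
        unfolding g_def fd_dilate[OF f r' z] .
      also have "\<dots> \<le> e * bnorm z u"
        using e z by (intro mult_left_mono bnorm_dilate r') auto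
      finally have "cmod (fd g z u) \<le> e * bnorm z u" .
      moreover have "cmod (fd f z u) \<le> e * bnorm z u" using near[of z u] False \<sigma> z by simp
      ultimately show ?thesis using norm_triangle_ineq4[of "fd f z u" "fd g z u"] by simp
    qed
    have "bloch_norm (\<lambda>z. f z - p z) \<le> cmod (f 0 - p 0) + 3 * e"
    proof (rule blochI(2)[OF holo_on_diff[OF f hp]])
      fix z u :: "complex ^ 'n" assume z: "z \<in> unit_ball"
      have "fd f z u - fd p z u = (fd f z u - fd g z u) + (fd g z u - fd p z u)" by simp
      also have "cmod \<dots> \<le> 2 * e * bnorm z u + e * bnorm z u"
        by (rule order_trans[OF norm_triangle_ineq add_mono[OF 2[OF z] 1[OF z]]])
      finally show "cmod (fd (\<lambda>z. f z - p z) z u) \<le> 3 * e * bnorm z u"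
        unfolding fd_diff[OF f hp z] by (simp add: algebra_simps)
    qed (use e in simp)
    moreover have "cmod (f 0 - p 0) \<le> e"
    proof -
      have "cmod (f 0 - P 0) < e * (1 - r) / 2" using P(2)[of 0] r by (simp add: s_def)
      also have "\<dots> \<le> e" using r e by (simp add: mult_left_le)
      finally show ?thesis by (simp add: p_def)
    qed
    ultimately have "bloch_norm (\<lambda>z. f z - p z) < \<epsilon>" using e by (simp add: e_def)
    then show ?thesis using pp polynomials_vanish(1) by blast
  qed
  then show ?thesis using vanishes_imp_bloch[OF assms] by (simp add: little_bloch_def)
qed

lemma little_bloch_iff: "f \<in> little_bloch \<longleftrightarrow> holo_on unit_ball f \<and> vanishes_at_sphere f"
proof
  assume f: "f \<in> little_bloch"
  then have "f \<in> bloch" by (simp add: little_bloch_def)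
  then show "holo_on unit_ball f \<and> vanishes_at_sphere f"
    using little_bloch_imp_vanishes[OF f] blochD(1) by blast
qed (simp add: vanishes_imp_little_bloch)

lemma tendsto_to_sphere_iff:
  fixes g :: "complex ^ 'n \<Rightarrow> ennreal"
  shows "(g \<longlongrightarrow> 0) to_sphere \<longleftrightarrow> (\<forall>\<epsilon>>0. \<exists>\<rho><1. \<forall>z. \<rho> < norm z \<and> norm z < 1 \<longrightarrow> g z \<le> ennreal \<epsilon>)"
proof -
  have ev: "eventually P to_sphere \<longleftrightarrow> (\<exists>\<rho><1. \<forall>z. \<rho> < norm z \<and> norm z < 1 \<longrightarrow> P z)"
    for P :: "complex ^ 'n \<Rightarrow> bool"
  proof
    assume "eventually P to_sphere"
    then obtain R where "eventually R (at_left 1)" and R: "\<And>z. R (norm z) \<Longrightarrow> P z"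
      unfolding to_sphere_def eventually_filtercomap by blast
    then obtain \<rho> where "\<rho> < 1" "\<And>y. \<rho> < y \<Longrightarrow> y < 1 \<Longrightarrow> R y"
      using eventually_at_left[of 0 "1 :: real"] by auto
    with R show "\<exists>\<rho><1. \<forall>z. \<rho> < norm z \<and> norm z < 1 \<longrightarrow> P z" by blast
  next
    assume "\<exists>\<rho><1. \<forall>z. \<rho> < norm z \<and> norm z < 1 \<longrightarrow> P z"
    then obtain \<rho> where \<rho>: "\<rho> < 1" "\<And>z. \<rho> < norm z \<and> norm z < 1 \<longrightarrow> P z" by blast
    have "eventually (\<lambda>y. \<rho> < y \<and> y < 1) (at_left 1)"
      using \<rho>(1) eventually_at_left[of \<rho> "1 :: real"] by auto
    with \<rho>(2) show "eventually P to_sphere"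
      unfolding to_sphere_def eventually_filtercomap by (intro exI[of _ "\<lambda>y. \<rho> < y \<and> y < 1"]) blast
  qed
  show ?thesis
  proof
    assume L: "(g \<longlongrightarrow> 0) to_sphere"
    show "\<forall>\<epsilon>>0. \<exists>\<rho><1. \<forall>z. \<rho> < norm z \<and> norm z < 1 \<longrightarrow> g z \<le> ennreal \<epsilon>"
    proof (intro allI impI)
      fix \<epsilon> :: real assume "\<epsilon> > 0"
      then have "eventually (\<lambda>z. g z < ennreal \<epsilon>) to_sphere"
        using order_tendstoD(2)[OF L, of "ennreal \<epsilon>"] by simp
      then show "\<exists>\<rho><1. \<forall>z. \<rho> < norm z \<and> norm z < 1 \<longrightarrow> g z \<le> ennreal \<epsilon>"
        unfolding ev using less_imp_le by blast
    qed
  next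
    assume R: "\<forall>\<epsilon>>0. \<exists>\<rho><1. \<forall>z. \<rho> < norm z \<and> norm z < 1 \<longrightarrow> g z \<le> ennreal \<epsilon>"
    show "(g \<longlongrightarrow> 0) to_sphere"
    proof (rule order_tendstoI)
      fix a :: ennreal assume "0 < a"
      \<comment> \<open>An intermediate value serves twice: it is finite even if \<open>a\<close> is
        infinite, and it turns \<le> into a strict inequality.\<close>
      then obtain x where x: "0 < x" "x < a" using dense by blast
      then obtain \<epsilon> where \<epsilon>: "x = ennreal \<epsilon>" "0 \<le> \<epsilon>" by (cases x) auto
      with x have "\<epsilon> > 0" by simp
      with R obtain \<rho> where "\<rho> < 1" "\<And>z. \<rho> < norm z \<and> norm z < 1 \<longrightarrow> g z \<le> ennreal \<epsilon>" by blast
      then show "eventually (\<lambda>z. g z < a) to_sphere"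
        unfolding ev using x(2) unfolding \<epsilon>(1) by (intro exI[of _ \<rho>]) (auto intro: le_less_trans)
    qed simp
  qed
qed

section \<open>Compactness of weighted composition operators\<close>

lemma H_inf_iff: "f \<in> H_inf \<longleftrightarrow> holo_on unit_ball f \<and> (\<exists>c. \<forall>z\<in>unit_ball. cmod (f z) \<le> c)"
  by (auto simp: H_inf_def holo_on_ball_eq bounded_iff)

lemma H_inf_norm_bound:
  assumes "f \<in> H_inf" "z \<in> unit_ball"
  shows "cmod (f z) \<le> H_inf_norm f"
proof -
  have "\<exists>c. \<forall>z\<in>unit_ball. cmod (f z) \<le> c" using assms(1) by (simp only: H_inf_iff)
  then obtain c where "\<forall>z\<in>unit_ball. cmod (f z) \<le> c" ..
  then have "bdd_above ((\<lambda>z. cmod (f z)) ` unit_ball)" by (intro bdd_aboveI2[of _ _ c]) blast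
  then show ?thesis unfolding H_inf_norm_def by (rule cSUP_upper[OF assms(2)])
qed

lemma H_inf_norm_nonneg: "f \<in> H_inf \<Longrightarrow> 0 \<le> H_inf_norm f"
  by (rule order_trans[OF norm_ge_zero H_inf_norm_bound[of f 0]]) auto

lemma H_infI:
  assumes "holo_on unit_ball f" "\<And>z. z \<in> unit_ball \<Longrightarrow> cmod (f z) \<le> c"
  shows "f \<in> H_inf" "H_inf_norm f \<le> c"
proof -
  show "f \<in> H_inf" unfolding H_inf_iff using assms by blast
  show "H_inf_norm f \<le> c" unfolding H_inf_norm_def by (rule cSUP_least[OF _ assms(2)]) auto
qed

lemma holo_self_mapD:
  assumes "holo_self_map \<phi>"
  shows "holo_on unit_ball (\<lambda>z. \<phi> z $ i)" "\<phi> ` unit_ball \<subseteq> unit_ball"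
    "z \<in> unit_ball \<Longrightarrow> norm (\<phi> z) < 1" "holo_on unit_ball f \<Longrightarrow> holo_on unit_ball (f \<circ> \<phi>)"
proof -
  show c: "holo_on unit_ball (\<lambda>z. \<phi> z $ i)" and s: "\<phi> ` unit_ball \<subseteq> unit_ball" for i
    using assms unfolding holo_self_map_def holo_on_ball_eq by blast+
  show "norm (\<phi> z) < 1" if "z \<in> unit_ball"
    using subsetD[OF s imageI[OF that]] by simp
  show "holo_on unit_ball (f \<circ> \<phi>)" if "holo_on unit_ball f" by (rule holo_on_compose[OF c s that])
qed

lemma theta_le_iff:
  assumes \<phi>: "holo_self_map \<phi>" and z: "z \<in> unit_ball" and "0 \<le> a" "0 \<le> c"
  shows "ennreal a * theta \<phi> z \<le> ennreal c \<longleftrightarrow>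
    (\<forall>f\<in>H_inf. H_inf_norm f \<le> 1 \<longrightarrow> (\<forall>u. a * cmod (fd (f \<circ> \<phi>) z u) \<le> c * bnorm z u))"
proof -
  have "ennreal a * theta \<phi> z \<le> ennreal c \<longleftrightarrow>
      (\<forall>f\<in>H_inf. H_inf_norm f \<le> 1 \<longrightarrow> ennreal a * Q (f \<circ> \<phi>) z \<le> ennreal c)"
    unfolding theta_def SUP_mult_left_ennreal by (auto simp: SUP_le_iff)
  also have "\<dots> \<longleftrightarrow>
      (\<forall>f\<in>H_inf. H_inf_norm f \<le> 1 \<longrightarrow> (\<forall>u. a * cmod (fd (f \<circ> \<phi>) z u) \<le> c * bnorm z u))"
    using Q_le_iff[OF holo_self_mapD(4)[OF \<phi>] z assms(3,4)] by (auto simp: H_inf_iff)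
  finally show ?thesis .
qed

lemma
  fixes \<phi> :: "complex ^ 'n \<Rightarrow> complex ^ 'n"
  assumes \<phi>: "holo_self_map \<phi>" and \<psi>: "holo_on unit_ball \<psi>" and f: "holo_on unit_ball f"
  shows holo_on_weighted_comp: "holo_on unit_ball (weighted_comp \<psi> \<phi> f)"
    and fd_weighted_comp: "z \<in> unit_ball \<Longrightarrow>
      fd (weighted_comp \<psi> \<phi> f) z u = \<psi> z * fd (f \<circ> \<phi>) z u + fd \<psi> z u * f (\<phi> z)"
  using holo_on_mult[OF \<psi> holo_self_mapD(4)[OF \<phi> f]] fd_mult[OF \<psi> holo_self_mapD(4)[OF \<phi> f]]
  by (simp_all add: weighted_comp_def)

lemma linear_operator_weighted_comp:
  "(\<And>f. f \<in> X \<Longrightarrow> weighted_comp \<psi> \<phi> f \<in> Y) \<Longrightarrow> linear_operator X Y (weighted_comp \<psi> \<phi>)"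
  by (auto simp: linear_operator_def weighted_comp_def fun_eq_iff algebra_simps)

section \<open>Normal families on the ball\<close>

lemma holo_on_unit_ball_limit:
  fixes f :: "nat \<Rightarrow> complex ^ 'n \<Rightarrow> complex"
  assumes f: "\<And>n. holo_on unit_ball (f n)"
    and ul: "\<And>\<tau>. \<tau> < 1 \<Longrightarrow> uniform_limit (cball 0 \<tau>) f g sequentially"
  shows "holo_on unit_ball g" "z \<in> unit_ball \<Longrightarrow> (\<lambda>n. fd (f n) z v) \<longlonglongrightarrow> fd g z v"
proof -
  have loc: "\<exists>r>0. cball z r \<subseteq> unit_ball \<and> uniform_limit (cball z r) f g sequentially"
    if z: "z \<in> unit_ball" for z
  proof -
    define t where "t = (1 - norm z) / 2"
    have t: "t > 0" "norm z + t < 1" using z by (auto simp: t_def field_simps)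
    have s: "cball z t \<subseteq> cball 0 (norm z + t)"
    proof
      fix y assume "y \<in> cball z t"
      then show "y \<in> cball 0 (norm z + t)"
        using norm_triangle_sub[of y z] by (simp add: dist_norm norm_minus_commute)
    qed
    moreover have "cball 0 (norm z + t) \<subseteq> (unit_ball :: (complex ^ 'n) set)" using t by auto
    ultimately show ?thesis
      using t(1) uniform_limit_on_subset[OF ul[OF t(2)] s] by blast
  qed
  show "holo_on unit_ball g" by (rule holo_on_uniform_limit(1)[OF f loc])
  show "z \<in> unit_ball \<Longrightarrow> (\<lambda>n. fd (f n) z v) \<longlonglongrightarrow> fd g z v"
    by (rule holo_on_uniform_limit(2)[OF f loc])
qed

text \<open>The second assumption says that \<open>k2\<close> is, from \<open>N\<close> on, drawn
  from ever later terms of \<open>k1\<close>; this is the form in which the diagonal argument hands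
  over its sequences.\<close>

lemma uniform_limit_subsequence:
  assumes "uniform_limit X (F \<circ> k1) l sequentially" "\<And>j. N \<le> j \<Longrightarrow> \<exists>j'\<ge>j. k2 j = k1 j'"
  shows "uniform_limit X (F \<circ> k2) l sequentially"
proof (rule uniform_limitI)
  fix e :: real assume "e > 0"
  from uniform_limitD[OF assms(1) this]
  obtain N' where N': "\<And>n x. n \<ge> N' \<Longrightarrow> x \<in> X \<Longrightarrow> dist ((F \<circ> k1) n x) (l x) < e"
    unfolding eventually_sequentially by blast
  have "dist ((F \<circ> k2) n x) (l x) < e" if n: "n \<ge> max N N'" and x: "x \<in> X" for n x
  proof -
    obtain j' where "j' \<ge> n" "k2 n = k1 j'" using assms(2)[of n] n by auto
    then show ?thesis using N'[of j' x] n x by simp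
  qed
  then show "\<forall>\<^sub>F n in sequentially. \<forall>x\<in>X. dist ((F \<circ> k2) n x) (l x) < e"
    unfolding eventually_sequentially by blast
qed

text \<open>On each ball of an exhaustion Cauchy's estimate gives a common Lipschitz constant, so
  Arzela-Ascoli applies; a diagonal sequence then serves all the balls at once.\<close>

lemma Montel_unit_ball:
  fixes F :: "nat \<Rightarrow> complex ^ 'n \<Rightarrow> complex"
  assumes F: "\<And>k. holo_on unit_ball (F k)" and M': "\<And>k. \<forall>z\<in>unit_ball. cmod (F k z) \<le> M"
  shows "\<exists>g r. strict_mono (r :: nat \<Rightarrow> nat) \<and> holo_on unit_ball g \<and> (\<forall>z\<in>unit_ball. cmod (g z) \<le> M) \<and>
    (\<forall>\<tau><1. uniform_limit (cball 0 \<tau>) (F \<circ> r) g sequentially)"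
proof -
  note M = M'[rule_format]
  define K where "K = (\<lambda>i::nat. cball (0 :: complex ^ 'n) (1 - 1 / (real i + 2)))"
  have M0: "M \<ge> 0" using order_trans[OF norm_ge_zero M[of 0 0]] by simp
  have sub: "\<exists>k. strict_mono (k :: nat \<Rightarrow> nat) \<and> (\<exists>l. uniform_limit (K i) (F \<circ> (s \<circ> k)) l sequentially)"
    for i and s :: "nat \<Rightarrow> nat"
  proof -
    define \<rho> where "\<rho> = 1 - 1 / (real i + 2)"
    have \<rho>: "0 \<le> \<rho>" "\<rho> < 1" by (auto simp: \<rho>_def)
    have K: "K i = cball 0 \<rho>" by (simp add: K_def \<rho>_def)
    define L where "L = 2 * M / (1 - \<rho>)"
    have L: "L \<ge> 0" using M0 \<rho> by (simp add: L_def)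
    have lip: "cmod (F n x - F n y) \<le> L * norm (x - y)" if "x \<in> cball 0 \<rho>" "y \<in> cball 0 \<rho>" for n x y
    proof (rule differentiable_bound[OF convex_cball _ _ that])
      fix w :: "complex ^ 'n" assume w: "w \<in> cball 0 \<rho>"
      then have "w \<in> unit_ball" using \<rho> by simp
      then show "(F n has_derivative fd (F n) w) (at w within cball 0 \<rho>)"
        using has_derivative_fd[OF F] has_derivative_at_withinI by blast
      show "onorm (fd (F n) w) \<le> L"
        unfolding L_def by (rule onorm_le, rule fd_interior_bound(1)[OF F \<rho>]) (use w M \<rho> in auto)
    qed
    obtain g and k :: "nat \<Rightarrow> nat" where k: "strict_mono k"
      and g: "\<And>e. 0 < e \<Longrightarrow> \<exists>N. \<forall>n x. n \<ge> N \<and> x \<in> cball 0 \<rho> \<longrightarrow> norm (F (s (k n)) x - g x) < e"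
    proof (rule Arzela_Ascoli[OF compact_cball, of 0 \<rho> "\<lambda>n. F (s n)" M])
      show "cmod (F (s n) x) \<le> M" if "x \<in> cball 0 \<rho>" for n x
        using M[of x] that \<rho> by simp
      fix x :: "complex ^ 'n" and e :: real
      assume x: "x \<in> cball 0 \<rho>" and e: "0 < e"
      show "\<exists>d>0. \<forall>n y. y \<in> cball 0 \<rho> \<and> norm (x - y) < d \<longrightarrow> cmod (F (s n) x - F (s n) y) < e"
      proof (intro exI[of _ "e / (L + 1)"] conjI allI impI)
        fix n y assume y: "y \<in> cball 0 \<rho> \<and> norm (x - y) < e / (L + 1)"
        have "cmod (F (s n) x - F (s n) y) \<le> L * norm (x - y)" using lip x y by blast
        also have "\<dots> \<le> L * (e / (L + 1))" using y L by (intro mult_left_mono) auto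
        also have "\<dots> < e" using L e by (simp add: divide_less_eq)
        finally show "cmod (F (s n) x - F (s n) y) < e" .
      qed (use L e in simp)
    qed blast
    have "uniform_limit (K i) (F \<circ> (s \<circ> k)) g sequentially"
    proof (rule uniform_limitI)
      fix e :: real assume "e > 0"
      from g[OF this] show "\<forall>\<^sub>F n in sequentially. \<forall>x\<in>K i. dist ((F \<circ> (s \<circ> k)) n x) (g x) < e"
        unfolding eventually_sequentially K dist_norm o_def by blast
    qed
    with k show ?thesis by blast
  qed
  obtain r :: "nat \<Rightarrow> nat" where r: "strict_mono r" "\<And>i. \<exists>l. uniform_limit (K i) (F \<circ> (id \<circ> r)) l sequentially"
  proof (rule subsequence_diagonalization_lemma[of "\<lambda>i s. \<exists>l. uniform_limit (K i) (F \<circ> s) l sequentially" id, OF sub])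
    fix i s k1 k2 and N :: nat
    assume "\<exists>l. uniform_limit (K i) (F \<circ> (s \<circ> k1)) l sequentially"
      and sel: "\<And>j. N \<le> j \<Longrightarrow> \<exists>j'\<ge>j. k2 j = k1 j'"
    then obtain l where "uniform_limit (K i) ((F \<circ> s) \<circ> k1) l sequentially" unfolding o_assoc by blast
    from uniform_limit_subsequence[OF this sel]
    show "\<exists>l. uniform_limit (K i) (F \<circ> (s \<circ> k2)) l sequentially" unfolding o_assoc by blast
  qed blast
  obtain l where l: "\<And>i. uniform_limit (K i) (F \<circ> r) (l i) sequentially" using r(2) by (simp, metis)
  \<comment> \<open>The limits \<open>l i\<close> on the different balls are glued by defining the
    limit pointwise, without reference to \<open>i\<close>.\<close>
  define g where "g = (\<lambda>z. lim (\<lambda>n. F (r n) z))"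
  have "l i z = g z" if "z \<in> K i" for i z
    using tendsto_uniform_limitI[OF l that] limI by (fastforce simp: g_def o_def)
  then have ulK: "uniform_limit (K i) (F \<circ> r) g sequentially" for i
    using l[of i] by (simp cong: uniform_limit_cong')
  have ul: "uniform_limit (cball 0 \<tau>) (F \<circ> r) g sequentially" if \<tau>: "\<tau> < 1" for \<tau>
  proof -
    obtain i where "1 / (1 - \<tau>) < real i" using reals_Archimedean2 by blast
    then have "1 < (1 - \<tau>) * real i" using \<tau> by (simp add: divide_less_eq mult.commute)
    also have "\<dots> \<le> (1 - \<tau>) * (real i + 2)" using \<tau> by simp
    finally have "1 / (real i + 2) < 1 - \<tau>" by (simp add: divide_less_eq)
    then have "cball 0 \<tau> \<subseteq> K i" by (auto simp: K_def)
    then show ?thesis using ulK uniform_limit_on_subset by blast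
  qed
  have hg: "holo_on unit_ball g"
    by (rule holo_on_unit_ball_limit(1)[where f = "F \<circ> r"]) (simp_all add: F ul)
  have "cmod (g z) \<le> M" if z: "z \<in> unit_ball" for z
  proof (rule tendsto_upperbound)
    show "(\<lambda>n. cmod ((F \<circ> r) n z)) \<longlonglongrightarrow> cmod (g z)"
      by (rule tendsto_norm, rule tendsto_uniform_limitI[OF ul[of "norm z"]]) (use z in auto)
  qed (use M z in auto)
  with r(1) hg ul show ?thesis by blast
qed

section \<open>From condition (c) to compactness\<close>

definition psi_theta_vanishes :: "(complex ^ 'n \<Rightarrow> complex) \<Rightarrow> (complex ^ 'n \<Rightarrow> complex ^ 'n) \<Rightarrow> bool" where
  "psi_theta_vanishes \<psi> \<phi> \<longleftrightarrow>
     (\<forall>\<epsilon>>0. \<exists>\<rho><1. \<forall>z. \<rho> < norm z \<and> norm z < 1 \<longrightarrow>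
        (\<forall>f\<in>H_inf. H_inf_norm f \<le> 1 \<longrightarrow> (\<forall>u. cmod (\<psi> z) * cmod (fd (f \<circ> \<phi>) z u) \<le> \<epsilon> * bnorm z u)))"

lemma psi_theta_vanishes_iff:
  assumes \<phi>: "holo_self_map \<phi>"
  shows "((\<lambda>z. ennreal (cmod (\<psi> z)) * theta \<phi> z) \<longlongrightarrow> 0) to_sphere \<longleftrightarrow> psi_theta_vanishes \<psi> \<phi>"
  unfolding tendsto_to_sphere_iff psi_theta_vanishes_def
  by (intro iff_allI imp_cong ex_cong1 conj_cong refl) (simp add: theta_le_iff[OF \<phi>])

text \<open>Each term of the product rule contributes half of \<epsilon>. The radius is independent
  of \<open>f\<close>. Using an arbitrary positive bound \<open>N\<close> in place of the norm
  permits division by it even for \<open>f = 0\<close>.\<close>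

lemma fd_weighted_comp_near_sphere:
  fixes \<phi> :: "complex ^ 'n \<Rightarrow> complex ^ 'n"
  assumes \<phi>: "holo_self_map \<phi>" and \<psi>: "holo_on unit_ball \<psi>"
    and van: "vanishes_at_sphere \<psi>" "psi_theta_vanishes \<psi> \<phi>" and \<epsilon>: "\<epsilon> > 0"
  shows "\<exists>\<rho>. 0 \<le> \<rho> \<and> \<rho> < 1 \<and> (\<forall>f\<in>H_inf. \<forall>N>0. (\<forall>w\<in>unit_ball. cmod (f w) \<le> N) \<longrightarrow>
    (\<forall>z u. \<rho> < norm z \<longrightarrow> norm z < 1 \<longrightarrow> cmod (fd (weighted_comp \<psi> \<phi> f) z u) \<le> \<epsilon> * N * bnorm z u))"
proof -
  obtain \<rho>1 where \<rho>1: "\<rho>1 < 1"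
    "\<And>z u. \<rho>1 < norm z \<and> norm z < 1 \<longrightarrow> cmod (fd \<psi> z u) \<le> \<epsilon> / 2 * bnorm z u"
    using van(1) half_gt_zero[OF \<epsilon>] unfolding vanishes_at_sphere_def by meson
  obtain \<rho>2 where \<rho>2: "\<rho>2 < 1"
    "\<And>z. \<rho>2 < norm z \<and> norm z < 1 \<longrightarrow> (\<forall>f\<in>H_inf. H_inf_norm f \<le> 1 \<longrightarrow>
       (\<forall>u. cmod (\<psi> z) * cmod (fd (f \<circ> \<phi>) z u) \<le> \<epsilon> / 2 * bnorm z u))"
    using van(2) half_gt_zero[OF \<epsilon>] unfolding psi_theta_vanishes_def by meson
  define \<rho> where "\<rho> = max 0 (max \<rho>1 \<rho>2)"
  have \<rho>: "0 \<le> \<rho>" "\<rho> < 1" "\<rho>1 \<le> \<rho>" "\<rho>2 \<le> \<rho>" using \<rho>1 \<rho>2 by (auto simp: \<rho>_def)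
  have outer: "cmod (fd (weighted_comp \<psi> \<phi> f) z u) \<le> \<epsilon> * N * bnorm z u"
    if f: "f \<in> H_inf" and N: "0 < N" "\<And>w. w \<in> unit_ball \<Longrightarrow> cmod (f w) \<le> N"
      and z: "\<rho> < norm z" "norm z < 1" for f N z u
  proof -
    have hf: "holo_on unit_ball f" using f H_inf_iff by blast
    have zb: "z \<in> unit_ball" using z by simp
    define f' where "f' = (\<lambda>z. (1 / of_real N) * f z)"
    have hf': "holo_on unit_ball f'" unfolding f'_def by (rule holo_on_cmult[OF hf])
    have bf': "cmod (f' w) \<le> 1" if "w \<in> unit_ball" for w
      using N(2)[OF that] N(1) by (simp add: f'_def norm_mult norm_divide divide_le_eq)
    have "cmod (\<psi> z) * cmod (fd (f' \<circ> \<phi>) z u) \<le> \<epsilon> / 2 * bnorm z u"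
      using \<rho>2(2)[of z] H_infI[OF hf' bf'] z \<rho>(4) by auto
    moreover have "fd (f' \<circ> \<phi>) z u = (1 / of_real N) * fd (f \<circ> \<phi>) z u"
      using fd_cmult[OF holo_self_mapD(4)[OF \<phi> hf] zb, of "1 / of_real N" u] by (simp add: f'_def o_def)
    ultimately have "cmod (\<psi> z) * cmod (fd (f \<circ> \<phi>) z u) / N \<le> \<epsilon> / 2 * bnorm z u"
      using N by (simp add: norm_mult norm_divide)
    then have 1: "cmod (\<psi> z * fd (f \<circ> \<phi>) z u) \<le> \<epsilon> / 2 * bnorm z u * N"
      using N by (simp add: pos_divide_le_eq norm_mult)
    have "cmod (fd \<psi> z u) * cmod (f (\<phi> z)) \<le> (\<epsilon> / 2 * bnorm z u) * N"
    proof (rule mult_mono)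
      show "cmod (fd \<psi> z u) \<le> \<epsilon> / 2 * bnorm z u" using \<rho>1(2)[of z u] z \<rho>(3) by simp
      show "cmod (f (\<phi> z)) \<le> N" using N(2)[of "\<phi> z"] holo_self_mapD(3)[OF \<phi> zb] by simp
      show "0 \<le> \<epsilon> / 2 * bnorm z u" using \<epsilon> bnorm_nonneg[of z u] z by simp
    qed simp
    then have 2: "cmod (fd \<psi> z u * f (\<phi> z)) \<le> \<epsilon> / 2 * bnorm z u * N" by (simp add: norm_mult)
    have "cmod (fd (weighted_comp \<psi> \<phi> f) z u) \<le> \<epsilon> / 2 * bnorm z u * N + \<epsilon> / 2 * bnorm z u * N"
      unfolding fd_weighted_comp[OF \<phi> \<psi> hf zb]
      by (rule order_trans[OF norm_triangle_ineq add_mono[OF 1 2]])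
    then show ?thesis by (simp add: mult_ac)
  qed
  with \<rho>(1,2) show ?thesis by blast
qed

text \<open>
  The estimate behind boundedness and compactness alike: up to \<open>\<epsilon>\<close> times the norm of \<open>f\<close>, the
  Bloch norm of the image is controlled by the size of \<open>f\<close> on \<open>\<phi>(\<rho>B)\<close>, a relatively compact
  subset of the ball.
\<close>

lemma bloch_norm_weighted_comp:
  fixes \<phi> :: "complex ^ 'n \<Rightarrow> complex ^ 'n"
  assumes \<phi>: "holo_self_map \<phi>" and \<psi>: "holo_on unit_ball \<psi>"
    and van: "vanishes_at_sphere \<psi>" "psi_theta_vanishes \<psi> \<phi>" and \<epsilon>: "\<epsilon> > 0"
  shows "\<exists>\<rho> K. 0 \<le> \<rho> \<and> \<rho> < 1 \<and> 0 \<le> K \<and> (\<forall>f\<in>H_inf. \<forall>N>0. \<forall>m\<ge>0. (\<forall>w\<in>unit_ball. cmod (f w) \<le> N) \<longrightarrow>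
    (\<forall>w. norm w \<le> (1 + \<rho>) / 2 \<longrightarrow> cmod (f (\<phi> w)) \<le> m) \<longrightarrow>
    bloch_norm (weighted_comp \<psi> \<phi> f) \<le> \<epsilon> * N + K * m)"
proof -
  obtain \<rho> where \<rho>: "0 \<le> \<rho>" "\<rho> < 1" and outer0: "(\<forall>f\<in>H_inf. \<forall>N>0. (\<forall>w\<in>unit_ball. cmod (f w) \<le> N) \<longrightarrow>
    (\<forall>z u. \<rho> < norm z \<longrightarrow> norm z < 1 \<longrightarrow> cmod (fd (weighted_comp \<psi> \<phi> f) z u) \<le> \<epsilon> * N * bnorm z u))"
    using fd_weighted_comp_near_sphere[OF assms] by blast
  note outer = outer0[rule_format]
  define \<sigma> where "\<sigma> = (1 + \<rho>) / 2"
  have \<sigma>: "\<sigma> < 1" "0 \<le> \<sigma>" using \<rho> by (auto simp: \<sigma>_def)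
  obtain P where P: "0 \<le> P" "\<And>w. norm w \<le> \<sigma> \<Longrightarrow> cmod (\<psi> w) \<le> P"
    using holo_on_bounded_interior[OF \<psi> \<sigma>(1)] by blast
  \<comment> \<open>The first summand is Cauchy's estimate on |z| \<le> \<rho>, the second accounts
    for the value of the image at 0.\<close>
  define K where "K = 2 * P / (1 - \<rho>) + P"
  have full: "bloch_norm (weighted_comp \<psi> \<phi> f) \<le> \<epsilon> * N + K * m"
    if f: "f \<in> H_inf" and N: "0 < N" "\<And>w. w \<in> unit_ball \<Longrightarrow> cmod (f w) \<le> N"
      and m: "0 \<le> m" "\<And>w. norm w \<le> (1 + \<rho>) / 2 \<Longrightarrow> cmod (f (\<phi> w)) \<le> m" for f N m
  proof -
    have hf: "holo_on unit_ball f" using f H_inf_iff by blast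
    note hW = holo_on_weighted_comp[OF \<phi> \<psi> hf]
    define a where "a = 2 * (P * m) / (1 - \<rho>)"
    have a: "0 \<le> a" "0 \<le> \<epsilon> * N" using P m \<rho> \<epsilon> N by (auto simp: a_def)
    have W: "cmod (weighted_comp \<psi> \<phi> f w) \<le> P * m" if "norm w \<le> (1 + \<rho>) / 2" for w
      unfolding weighted_comp_def norm_mult o_def
      using P m that by (intro mult_mono) (auto simp: \<sigma>_def)
    have "bloch_norm (weighted_comp \<psi> \<phi> f) \<le> cmod (weighted_comp \<psi> \<phi> f 0) + (\<epsilon> * N + a)"
    proof (rule blochI(2)[OF hW])
      show "0 \<le> \<epsilon> * N + a" using a by simp
      fix z u :: "complex ^ 'n" assume z: "z \<in> unit_ball"
      have "\<exists>c. c \<le> \<epsilon> * N + a \<and> cmod (fd (weighted_comp \<psi> \<phi> f) z u) \<le> c * bnorm z u"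
      proof (cases "norm z \<le> \<rho>")
        case True
        have "cmod (fd (weighted_comp \<psi> \<phi> f) z u) \<le> a * bnorm z u"
          unfolding a_def by (rule fd_interior_bound(2)[OF hW \<rho>(1,2) True W])
        then show ?thesis using a by (intro exI[of _ a]) simp
      next
        case False
        then have "cmod (fd (weighted_comp \<psi> \<phi> f) z u) \<le> (\<epsilon> * N) * bnorm z u"
          using outer[OF f N, of z u] z by simp
        then show ?thesis using a by (intro exI[of _ "\<epsilon> * N"]) simp
      qed
      then show "cmod (fd (weighted_comp \<psi> \<phi> f) z u) \<le> (\<epsilon> * N + a) * bnorm z u"
        using z by (auto intro: order_trans mult_right_mono bnorm_nonneg)
    qed
    moreover have "cmod (weighted_comp \<psi> \<phi> f 0) \<le> P * m" using W[of 0] \<rho> by simp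
    moreover have "K * m = a + P * m" by (simp add: K_def a_def algebra_simps)
    ultimately show ?thesis by simp
  qed
  have "0 \<le> K" using P \<rho> by (simp add: K_def)
  with \<rho> full show ?thesis by blast
qed

lemma weighted_comp_little_bloch:
  fixes \<phi> :: "complex ^ 'n \<Rightarrow> complex ^ 'n"
  assumes \<phi>: "holo_self_map \<phi>" and \<psi>: "holo_on unit_ball \<psi>"
    and van: "vanishes_at_sphere \<psi>" "psi_theta_vanishes \<psi> \<phi>" and f: "f \<in> H_inf"
  shows "weighted_comp \<psi> \<phi> f \<in> little_bloch"
  unfolding little_bloch_iff vanishes_at_sphere_def
proof (intro conjI allI impI)
  show "holo_on unit_ball (weighted_comp \<psi> \<phi> f)"
    using f holo_on_weighted_comp[OF \<phi> \<psi>] H_inf_iff by blast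
  fix \<epsilon> :: real assume \<epsilon>: "\<epsilon> > 0"
  define N where "N = H_inf_norm f + 1"
  have N: "0 < N" "\<And>w. w \<in> unit_ball \<Longrightarrow> cmod (f w) \<le> N"
    using H_inf_norm_nonneg[OF f] H_inf_norm_bound[OF f] by (auto simp: N_def add_increasing2)
  have "\<epsilon> / N > 0" using \<epsilon> N by simp
  then obtain \<rho> where \<rho>: "\<rho> < 1" and outer: "(\<forall>f\<in>H_inf. \<forall>N'>0. (\<forall>w\<in>unit_ball. cmod (f w) \<le> N') \<longrightarrow>
    (\<forall>z u. \<rho> < norm z \<longrightarrow> norm z < 1 \<longrightarrow> cmod (fd (weighted_comp \<psi> \<phi> f) z u) \<le> (\<epsilon> / N) * N' * bnorm z u))"
    using fd_weighted_comp_near_sphere[OF \<phi> \<psi> van] by blast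
  from outer[rule_format, OF f N] N(1)
  show "\<exists>\<rho><1. \<forall>z. \<rho> < norm z \<and> norm z < 1 \<longrightarrow>
      (\<forall>u. cmod (fd (weighted_comp \<psi> \<phi> f) z u) \<le> \<epsilon> * bnorm z u)"
    by (intro exI[of _ \<rho>]) (simp add: \<rho>)
qed

lemma weighted_comp_bounded:
  fixes \<phi> :: "complex ^ 'n \<Rightarrow> complex ^ 'n"
  assumes \<phi>: "holo_self_map \<phi>" and \<psi>: "holo_on unit_ball \<psi>"
    and van: "vanishes_at_sphere \<psi>" "psi_theta_vanishes \<psi> \<phi>"
  shows "bounded_operator H_inf H_inf_norm little_bloch bloch_norm (weighted_comp \<psi> \<phi>)"
  unfolding bounded_operator_def
proof
  show "linear_operator H_inf little_bloch (weighted_comp \<psi> \<phi>)"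
    by (intro linear_operator_weighted_comp weighted_comp_little_bloch assms)
  obtain \<rho> K where K: "0 \<le> \<rho>" "\<rho> < 1" "0 \<le> K" and est0: "(\<forall>f\<in>H_inf. \<forall>N>0. \<forall>m\<ge>0. (\<forall>w\<in>unit_ball. cmod (f w) \<le> N) \<longrightarrow>
    (\<forall>w. norm w \<le> (1 + \<rho>) / 2 \<longrightarrow> cmod (f (\<phi> w)) \<le> m) \<longrightarrow>
    bloch_norm (weighted_comp \<psi> \<phi> f) \<le> 1 * N + K * m)"
    using bloch_norm_weighted_comp[OF \<phi> \<psi> van zero_less_one] by blast
  note est = est0[rule_format]
  have "bloch_norm (weighted_comp \<psi> \<phi> f) \<le> (1 + K) * H_inf_norm f" if f: "f \<in> H_inf" for f
  \<comment> \<open>The estimate requires a positive bound \<open>N\<close>, while the norm of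
    \<open>f\<close> may be 0; so \<open>N\<close> is the norm plus an arbitrary
    \<open>e\<close>.\<close>
  proof (rule field_le_epsilon)
    fix e :: real assume e: "e > 0"
    define m where "m = H_inf_norm f"
    have m: "0 \<le> m" "\<And>w. w \<in> unit_ball \<Longrightarrow> cmod (f w) \<le> m"
      using H_inf_norm_nonneg[OF f] H_inf_norm_bound[OF f] by (auto simp: m_def)
    have "bloch_norm (weighted_comp \<psi> \<phi> f) \<le> 1 * (m + e) + K * m"
    proof (rule est[OF f])
      show "cmod (f w) \<le> m + e" if "w \<in> unit_ball" for w using m(2)[OF that] e by simp
      show "cmod (f (\<phi> w)) \<le> m" if "norm w \<le> (1 + \<rho>) / 2" for w
        using m(2)[of "\<phi> w"] holo_self_mapD(3)[OF \<phi>, of w] that K(2) by simp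
    qed (use m e in auto)
    then show "bloch_norm (weighted_comp \<psi> \<phi> f) \<le> (1 + K) * H_inf_norm f + e"
      by (simp add: m_def algebra_simps)
  qed
  then show "\<exists>C. \<forall>f\<in>H_inf. bloch_norm (weighted_comp \<psi> \<phi> f) \<le> C * H_inf_norm f" by blast
qed

text \<open>Montel's limit \<open>g\<close> need not be a limit in norm: the differences are merely
  bounded on the ball and small on compact subsets. This is exactly what the preceding estimate
  converts into a small Bloch norm.\<close>

lemma weighted_comp_compact:
  fixes \<phi> :: "complex ^ 'n \<Rightarrow> complex ^ 'n"
  assumes \<phi>: "holo_self_map \<phi>" and \<psi>: "holo_on unit_ball \<psi>"
    and van: "vanishes_at_sphere \<psi>" "psi_theta_vanishes \<psi> \<phi>"
  shows "compact_operator H_inf H_inf_norm little_bloch bloch_norm (weighted_comp \<psi> \<phi>)"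
  unfolding compact_operator_def
proof (intro conjI allI impI)
  show "bounded_operator H_inf H_inf_norm little_bloch bloch_norm (weighted_comp \<psi> \<phi>)"
    by (rule weighted_comp_bounded[OF assms])
  fix F :: "nat \<Rightarrow> complex ^ 'n \<Rightarrow> complex" and M
  assume FM: "\<forall>k. F k \<in> H_inf \<and> H_inf_norm (F k) \<le> M"
  then have F: "\<And>k. holo_on unit_ball (F k)" by (simp add: H_inf_iff)
  have M': "\<forall>z\<in>unit_ball. cmod (F k z) \<le> M" for k
    using FM order_trans[OF H_inf_norm_bound] by blast
  note M = M'[rule_format]
  obtain g r where r: "strict_mono (r :: nat \<Rightarrow> nat)" and hg: "holo_on unit_ball g"
    and gM0: "\<forall>z\<in>unit_ball. cmod (g z) \<le> M"
    and ul0: "\<forall>\<tau><1. uniform_limit (cball 0 \<tau>) (F \<circ> r) g sequentially"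
    using Montel_unit_ball[of F, OF F M'] by blast
  note gM = gM0[rule_format] and ul = ul0[rule_format]
  have g: "g \<in> H_inf" using H_infI(1)[OF hg gM] .
  have M0: "0 \<le> M" using order_trans[OF norm_ge_zero gM[of 0]] by simp
  \<comment> \<open>A bound for all differences, made strictly positive.\<close>
  define N where "N = 2 * M + 1"
  have N: "N > 0" using M0 by (simp add: N_def)
  define d where "d = (\<lambda>k z. F (r k) z - g z)"
  have dN: "cmod (d k z) \<le> N" if "z \<in> unit_ball" for k z
    using norm_triangle_ineq4[of "F (r k) z" "g z"] M[OF that, of "r k"] gM[OF that]
    by (simp add: d_def N_def)
  have d: "d k \<in> H_inf" for k
    by (rule H_infI(1)[OF _ dN]) (simp add: d_def holo_on_diff F hg)
  have W: "(\<lambda>y. weighted_comp \<psi> \<phi> (F (r k)) y - weighted_comp \<psi> \<phi> g y) = weighted_comp \<psi> \<phi> (d k)" for k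
    by (simp add: weighted_comp_def d_def fun_eq_iff algebra_simps)
  have "(\<lambda>k. bloch_norm (weighted_comp \<psi> \<phi> (d k))) \<longlonglongrightarrow> 0"
  proof (rule LIMSEQ_I)
    fix e :: real assume e: "e > 0"
    define \<epsilon> where "\<epsilon> = e / (3 * N)"
    have \<epsilon>: "\<epsilon> > 0" "\<epsilon> * N = e / 3" using e N by (auto simp: \<epsilon>_def)
    obtain \<rho> K where K: "0 \<le> \<rho>" "\<rho> < 1" "0 \<le> K" and est0: "(\<forall>f\<in>H_inf. \<forall>N>0. \<forall>m\<ge>0. (\<forall>w\<in>unit_ball. cmod (f w) \<le> N) \<longrightarrow>
    (\<forall>w. norm w \<le> (1 + \<rho>) / 2 \<longrightarrow> cmod (f (\<phi> w)) \<le> m) \<longrightarrow>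
    bloch_norm (weighted_comp \<psi> \<phi> f) \<le> \<epsilon> * N + K * m)"
      using bloch_norm_weighted_comp[OF \<phi> \<psi> van \<epsilon>(1)] by blast
    note est = est0[rule_format]
    have cont: "continuous_on unit_ball \<phi>"
      unfolding continuous_on_componentwise[of _ \<phi>]
    proof
      fix b :: "complex ^ 'n" assume "b \<in> Basis"
      then obtain i c where b: "b = axis i c" "c \<in> Basis" by (auto simp: Basis_vec_def)
      have "continuous_on unit_ball (\<lambda>x. \<phi> x $ i)"
        by (rule holo_on_continuous_on[OF holo_self_mapD(1)[OF \<phi>]])
      then show "continuous_on unit_ball (\<lambda>x. \<phi> x \<bullet> b)"
        by (auto simp: b inner_axis intro!: continuous_intros)
    qed
    have sub: "cball 0 ((1 + \<rho>) / 2) \<subseteq> (unit_ball :: (complex ^ 'n) set)" using K(2) by auto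
    have "continuous_on (cball 0 ((1 + \<rho>) / 2)) (\<lambda>w. norm (\<phi> w))"
      by (rule continuous_on_norm[OF continuous_on_subset[OF cont sub]])
    moreover have "(0 :: complex ^ 'n) \<in> cball 0 ((1 + \<rho>) / 2)" using K(1) by simp
    \<comment> \<open>By compactness \<phi> maps the closed ball of radius (1 + \<rho>)/2 into a
      closed ball of radius \<open>norm (\<phi> w0) < 1\<close>, where the subsequence converges
      uniformly.\<close>
    ultimately have "\<exists>x\<in>cball 0 ((1 + \<rho>) / 2). \<forall>y\<in>cball 0 ((1 + \<rho>) / 2). norm (\<phi> y) \<le> norm (\<phi> x)"
      by (intro continuous_attains_sup compact_cball) auto
    then obtain w0 where w0: "w0 \<in> cball 0 ((1 + \<rho>) / 2)"
        "\<And>w. w \<in> cball 0 ((1 + \<rho>) / 2) \<Longrightarrow> norm (\<phi> w) \<le> norm (\<phi> w0)" by blast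
    then have "norm (\<phi> w0) < 1" using holo_self_mapD(3)[OF \<phi>, of w0] K(2) by simp
    moreover have "0 < e / (3 * (K + 1))" using e K(3) by simp
    ultimately have "\<forall>\<^sub>F k in sequentially. \<forall>x\<in>cball 0 (norm (\<phi> w0)). dist ((F \<circ> r) k x) (g x) < e / (3 * (K + 1))"
      using uniform_limitD[OF ul] by blast
    then obtain k0 where "\<forall>k\<ge>k0. \<forall>x\<in>cball 0 (norm (\<phi> w0)). dist ((F \<circ> r) k x) (g x) < e / (3 * (K + 1))"
      unfolding eventually_sequentially by blast
    then have k0: "dist (F (r k) x) (g x) < e / (3 * (K + 1))" if "k \<ge> k0" "norm x \<le> norm (\<phi> w0)" for k x
      using that by simp
    have "norm (bloch_norm (weighted_comp \<psi> \<phi> (d k)) - 0) < e" if k: "k \<ge> k0" for k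
    proof -
      have "bloch_norm (weighted_comp \<psi> \<phi> (d k)) \<le> \<epsilon> * N + K * (e / (3 * (K + 1)))"
      proof (rule est[OF d N _ dN])
        show "cmod (d k (\<phi> w)) \<le> e / (3 * (K + 1))" if "norm w \<le> (1 + \<rho>) / 2" for w
          using k0[OF k, of "\<phi> w"] w0(2)[of w] that by (simp add: d_def dist_norm)
      qed (use e K(3) in auto)
      also have "K * (e / (3 * (K + 1))) \<le> e / 3"
        using e K(3) by (simp add: divide_le_eq mult_ac)
      finally have "bloch_norm (weighted_comp \<psi> \<phi> (d k)) < e" using \<epsilon>(2) e by simp
      moreover have "0 \<le> bloch_norm (weighted_comp \<psi> \<phi> (d k))" by (simp add: bloch_norm_def)
      ultimately show ?thesis by simp
    qed
    then show "\<exists>k0. \<forall>k\<ge>k0. norm (bloch_norm (weighted_comp \<psi> \<phi> (d k)) - 0) < e" by blast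
  qed
  then have "(\<lambda>k. bloch_norm (\<lambda>y. weighted_comp \<psi> \<phi> (F (r k)) y - weighted_comp \<psi> \<phi> g y)) \<longlonglongrightarrow> 0"
    by (simp only: W)
  then show "\<exists>r g. strict_mono r \<and> g \<in> little_bloch \<and>
      (\<lambda>k. bloch_norm (\<lambda>y. weighted_comp \<psi> \<phi> (F (r k)) y - g y)) \<longlonglongrightarrow> 0"
    using r weighted_comp_little_bloch[OF assms g] by blast
qed

section \<open>The gliding hump\<close>

text \<open>While x_j \<ge> 1 the terms 1/x_j at least double, so the sum is at most twice the last
  one; once x_j < 1 the terms x_j at least halve, so the last one bounds what is still to come. The
  bound depending on the last index records both regimes, which a constant bound could not do in an
  induction.\<close>

lemma sum_min_inverse_le:
  fixes x :: "nat \<Rightarrow> real"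
  assumes pos: "\<And>j. 0 < x j" and halve: "\<And>j. x (Suc j) \<le> x j / 2"
  shows "(\<Sum>j<N. min (x j) (1 / x j)) \<le> 4"
proof -
  have "(\<Sum>j<Suc N. min (x j) (1 / x j)) \<le> (if 1 \<le> x N then 2 / x N else 4 - x N)" for N
  proof (induction N)
    case 0
    show ?case using pos[of 0] by (auto simp: min_def divide_right_mono)
  next
    case (Suc N)
    define a b s where "a = x N" and "b = x (Suc N)" and "s = (\<Sum>j<Suc N. min (x j) (1 / x j))"
    have ab: "0 < a" "0 < b" "b \<le> a / 2" using pos halve by (auto simp: a_def b_def)
    have s: "s \<le> (if 1 \<le> a then 2 / a else 4 - a)" unfolding a_def s_def by (rule Suc.IH)
    have "s + min b (1 / b) \<le> (if 1 \<le> b then 2 / b else 4 - b)"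
    proof (cases "1 \<le> b")
      case True
      have "2 / a \<le> 1 / b" using ab by (simp add: field_simps)
      moreover have "s \<le> 2 / a" using s True ab by simp
      moreover have "1 / b + 1 / b = 2 / b" by simp
      moreover have "min b (1 / b) \<le> 1 / b" by simp
      ultimately have "s + min b (1 / b) \<le> 2 / b" by linarith
      then show ?thesis using True by simp
    next
      case False
      have "s \<le> 4 - 2 * b"
      proof (cases "1 \<le> a")
        case True
        then have "2 / a \<le> 2" by (simp add: divide_le_eq)
        moreover have "s \<le> 2 / a" using s True by simp
        ultimately show ?thesis using False by linarith
      next
        case False
        then show ?thesis using s ab by simp
      qed
      moreover have "min b (1 / b) \<le> b" by simp
      ultimately show ?thesis using False by simp
    qed
    then show ?case unfolding b_def s_def by (simp only: sum.lessThan_Suc)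
  qed
  moreover have "(if 1 \<le> x N then 2 / x N else 4 - x N) \<le> 4" for N
    using pos[of N] by (simp add: divide_le_eq)
  ultimately have le: "(\<Sum>j<Suc N. min (x j) (1 / x j)) \<le> 4" for N
    using order_trans by blast
  show ?thesis using le by (cases N) (simp, blast)
qed

text \<open>Recursive choice sees only the last index chosen, so the new index is required to
  satisfy the relation with every \<open>m\<close> up to that one, finitely many conditions that
  include all earlier choices.\<close>

lemma sparse_subsequence:
  assumes "\<And>j m. eventually (R j m) sequentially"
  obtains r :: "nat \<Rightarrow> nat" where "strict_mono r" "\<And>i j. i < j \<Longrightarrow> R j (r i) (r j)"
proof -
  have step: "\<exists>y. True \<and> (x < y \<and> (\<forall>m\<le>x. R (Suc n) m y))" for x n
  proof -
    have "eventually (\<lambda>y. \<forall>m\<in>{..x}. R (Suc n) m y) sequentially"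
      by (intro eventually_ball_finite) (auto simp: assms)
    then have "eventually (\<lambda>y. (\<forall>m\<in>{..x}. R (Suc n) m y) \<and> x < y) sequentially"
      by (intro eventually_conj eventually_gt_at_top)
    then show ?thesis unfolding eventually_sequentially by (metis atMost_iff order_refl)
  qed
  obtain r where r: "\<And>n. r n < r (Suc n) \<and> (\<forall>m\<le>r n. R (Suc n) m (r (Suc n)))"
    using dependent_nat_choice[of "\<lambda>_ _. True" "\<lambda>n x y. x < y \<and> (\<forall>m\<le>x. R (Suc n) m y)", OF _ step]
    by auto
  have mono: "strict_mono r" using r by (simp add: strict_mono_Suc_iff)
  have "R j (r i) (r j)" if "i < j" for i j
  proof -
    obtain n where j: "j = Suc n" using \<open>i < j\<close> by (cases j) auto
    then have "r i \<le> r n" using that strict_mono_less_eq[OF mono] by simp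
    then show ?thesis using r[of n] j by blast
  qed
  with mono show thesis using that by blast
qed

text \<open>
  On the right half-plane \<open>bump a\<close> is concentrated at \<open>|t| \<approx> a\<close> and decays to both sides, so bumps at
  geometrically decreasing scales are absolutely summable with a uniform bound.
\<close>

definition bump :: "real \<Rightarrow> complex \<Rightarrow> complex" where
  "bump a t = of_real a * t * (inverse (of_real a + t) * inverse (of_real a + t))"

lemma cmod_bump: "cmod (bump a t) = \<bar>a\<bar> * cmod t / (cmod (of_real a + t))\<^sup>2"
  by (simp add: bump_def norm_mult norm_inverse power2_eq_square divide_inverse)

text \<open>In |a + t|^2 = a^2 + 2a Re t + |t|^2 the middle term is nonnegative, so the denominator
  dominates both a^2 and |t|^2.\<close>

lemma cmod_bump_le:
  assumes "0 < a" "0 < Re t"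
  shows "cmod (bump a t) \<le> min (a / cmod t) (1 / (a / cmod t))"
proof -
  have t: "cmod t > 0" using assms(2) by auto
  have sq: "(cmod (of_real a + t))\<^sup>2 = a\<^sup>2 + 2 * a * Re t + (cmod t)\<^sup>2"
    unfolding cmod_power2 by (simp add: power2_eq_square algebra_simps)
  have nn: "0 \<le> 2 * a * Re t" using assms by simp
  have 1: "cmod (bump a t) \<le> a * cmod t / (cmod t)\<^sup>2"
    unfolding cmod_bump using assms t nn by (intro frac_le) (auto simp: sq)
  have 2: "cmod (bump a t) \<le> a * cmod t / a\<^sup>2"
    unfolding cmod_bump using assms t nn by (intro frac_le) (auto simp: sq)
  show ?thesis using 1 2 t assms by (simp add: power2_eq_square)
qed

lemma cmod_bump_ge: "1 / 4 \<le> cmod (bump a t)" if "0 < a" "cmod t = a" "0 < Re t"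
proof -
  have ne: "cmod (of_real a + t) > 0"
    using that complex_Re_le_cmod[of "of_real a + t"] by (simp del: zero_less_norm_iff)
  have "cmod (of_real a + t) \<le> 2 * a" using norm_triangle_ineq[of "of_real a" t] that by simp
  then have le: "(cmod (of_real a + t))\<^sup>2 \<le> (2 * a)\<^sup>2" by (rule power_mono) simp
  have "1 / 4 = a * a / (2 * a)\<^sup>2" using that by (simp add: power2_eq_square)
  also have "\<dots> \<le> a * a / (cmod (of_real a + t))\<^sup>2"
    using ne by (intro divide_left_mono le) (use that in auto)
  finally show ?thesis using that by (simp add: cmod_bump)
qed

text \<open>Re <z,\<xi>> is the real inner product, to which Cauchy-Schwarz applies. On the ball
  this puts 1 - <z,\<xi>> in the half-plane where the bumps are controlled.\<close>

lemma Re_one_minus_hprod: "1 - norm z \<le> Re (1 - hprod z \<xi>)" if "norm \<xi> = 1"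
proof -
  have "Re (hprod z \<xi>) = z \<bullet> \<xi>"
    by (simp add: hprod_def inner_vec_def inner_complex_def)
  then show ?thesis using norm_cauchy_schwarz[of z \<xi>] that by simp
qed

lemma holo_on_one_minus_hprod: "holo_on S (\<lambda>z. 1 - hprod z \<xi>)"
proof -
  have "(\<lambda>z. 1 - hprod z \<xi>) = (\<lambda>z. 1 - (\<Sum>j\<in>UNIV. cnj (\<xi> $ j) * z $ j))"
    by (simp add: hprod_def mult.commute)
  then show ?thesis
    by (simp only:) (intro holo_on_diff holo_on_const holo_on_sum holo_on_cmult holo_on_nth)
qed

lemma holo_on_bump:
  assumes t: "holo_on S t" and "\<And>z. z \<in> S \<Longrightarrow> 0 < Re (t z)" "0 < a"
  shows "holo_on S (\<lambda>z. bump a (t z))"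
proof -
  have at: "holo_on S (\<lambda>z. of_real a + t z)" by (intro holo_on_add holo_on_const t)
  have "holo_on S (\<lambda>z. inverse (of_real a + t z))"
  proof (rule holo_on_field_compose[OF at])
    fix z assume "z \<in> S"
    then have "Re (of_real a + t z) > 0" using assms by (simp add: add_pos_pos)
    then have "of_real a + t z \<noteq> 0" by (metis less_irrefl zero_complex.sel(1))
    then show "(inverse has_field_derivative - (inverse (of_real a + t z) ^ Suc (Suc 0))) (at (of_real a + t z))"
      by (rule DERIV_inverse)
  qed
  then show ?thesis unfolding bump_def by (intro holo_on_mult holo_on_const t)
qed

lemma sum_half_powers_le: "(\<Sum>i<N. (1 / 2 :: real) ^ i) \<le> 2"
proof -
  have "(\<Sum>i<N. (1 / 2 :: real) ^ i) = 2 - 2 * (1 / 2) ^ N" by (induction N) auto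
  then show ?thesis by simp
qed

text \<open>
  Gliding hump: each \<open>f\<^sub>k\<close>, normalised to vanish at \<open>w\<^sub>k\<close>, is cut off by a bump centred at \<open>w\<^sub>k\<close>.
  A sufficiently sparse subsequence of the results has a bounded sum, and at \<open>w\<^sub>k\<close> the derivative
  of the sum in direction \<open>v\<^sub>k\<close> is dominated by the \<open>k\<close>-th summand.
\<close>

lemma gliding_hump:
  fixes w v :: "nat \<Rightarrow> complex ^ 'n"
  assumes w: "\<And>k. norm (w k) < 1" and \<xi>: "norm \<xi> = 1" "w \<longlonglongrightarrow> \<xi>"
    and f: "\<And>k. holo_on unit_ball (f k)" and f1: "\<And>k z. norm z < 1 \<Longrightarrow> cmod (f k z) \<le> 1"
    and c: "0 < c" "\<And>k. c \<le> cmod (fd (f k) (w k) (v k))"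
    and lim: "\<And>g. g \<in> H_inf \<Longrightarrow> (\<lambda>k. fd g (w k) (v k)) \<longlonglongrightarrow> 0"
  shows False
proof -
  define t where "t = (\<lambda>z. 1 - hprod z \<xi>)"
  have Re_t: "1 - norm z \<le> Re (t z)" for z unfolding t_def by (rule Re_one_minus_hprod[OF \<xi>(1)])
  have t_ge: "1 - norm z \<le> cmod (t z)" for z using Re_t complex_Re_le_cmod order_trans by blast
  have ht: "holo_on S t" for S unfolding t_def by (rule holo_on_one_minus_hprod)
  \<comment> \<open>The scale is chosen so that the k-th bump has modulus at least 1/4 at
    \<open>w k\<close>.\<close>
  define a where "a = (\<lambda>k. cmod (t (w k)))"
  have a_pos: "0 < a k" for k using t_ge[of "w k"] w[of k] by (simp add: a_def del: zero_less_norm_iff)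
  have a_lim: "a \<longlonglongrightarrow> 0"
  proof -
    have "isCont t \<xi>"
      using holo_on_continuous_on[OF ht[of UNIV]] by (simp add: continuous_on_eq_continuous_at)
    then have "(\<lambda>k. t (w k)) \<longlonglongrightarrow> t \<xi>" using \<xi>(2) isCont_tendsto_compose by blast
    moreover have "t \<xi> = 0"
    proof -
      have "hprod \<xi> \<xi> = of_real ((norm \<xi>)\<^sup>2)"
        by (simp add: hprod_def norm_vec_def L2_set_def sum_nonneg complex_norm_square[symmetric])
      then show ?thesis using \<xi>(1) by (simp add: t_def)
    qed
    ultimately show ?thesis unfolding a_def using tendsto_norm by fastforce
  qed
  \<comment> \<open>The first factor vanishes at \<open>w k\<close>, so the product rule leaves only
    the derivative of \<open>f k\<close> times the bump there; the 1/2 brings that factor below 1 in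
    modulus.\<close>
  define F where "F = (\<lambda>k z. (1 / 2) * (f k z - f k (w k)) * bump (a k) (t z))"
  have Re_pos: "0 < Re (t z)" if "z \<in> unit_ball" for z using Re_t[of z] that by simp
  have hb: "holo_on unit_ball (\<lambda>z. bump (a k) (t z))" for k
    by (rule holo_on_bump[OF ht Re_pos a_pos])
  have hf: "holo_on unit_ball (\<lambda>z. (1 / 2) * (f k z - f k (w k)))" for k
    by (intro holo_on_cmult holo_on_diff f holo_on_const)
  have hF: "holo_on unit_ball (F k)" for k unfolding F_def by (intro holo_on_mult hf hb)
  have F_le: "cmod (F k z) \<le> min (a k / cmod (t z)) (1 / (a k / cmod (t z)))" if z: "norm z < 1" for k z
  proof -
    have "cmod ((1 / 2) * (f k z - f k (w k))) \<le> 1"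
      using norm_triangle_ineq4[of "f k z" "f k (w k)"] f1[OF z, of k] f1[OF w, of k k] by (simp add: norm_mult)
    then have "cmod (F k z) \<le> 1 * cmod (bump (a k) (t z))"
      unfolding F_def norm_mult[of "(1 / 2) * _"] by (intro mult_right_mono) auto
    then show ?thesis using cmod_bump_le[OF a_pos Re_pos, of z k] z by simp
  qed
  have F_le': "cmod (F k z) \<le> a k / (1 - norm z)" if z: "norm z < 1" for k z
  proof -
    have "cmod (F k z) \<le> a k / cmod (t z)" using F_le[OF z] by simp
    also have "\<dots> \<le> a k / (1 - norm z)"
      using z t_ge[of z] a_pos[of k] by (intro divide_left_mono) (auto intro!: mult_pos_pos)
    finally show ?thesis .
  qed
  have F_Hinf: "F k \<in> H_inf" for k
  proof (rule H_infI(1)[OF hF])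
    show "cmod (F k z) \<le> 1" if "z \<in> unit_ball" for z
    proof -
      have "min x (1 / x) \<le> 1" if "0 < x" for x :: real
        using that by (cases "x \<le> 1") (auto simp: min_le_iff_disj)
      moreover have "0 < a k / cmod (t z)" using a_pos[of k] Re_pos[OF that] by (intro divide_pos_pos) auto
      ultimately show ?thesis using F_le[of z k] that order_trans by fastforce
    qed
  qed
  define L where "L = (\<lambda>k g. fd g (w k) (v k))"
  have diag: "c / 8 \<le> cmod (L k (F k))" for k
  proof -
    have wk: "w k \<in> unit_ball" using w by simp
    have "fd (\<lambda>z. (1 / 2) * (f k z - f k (w k))) (w k) (v k) = (1 / 2) * fd (f k) (w k) (v k)"
      unfolding fd_cmult[OF holo_on_diff[OF f holo_on_const] wk] fd_diff[OF f holo_on_const wk] fd_const by simp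
    then have "L k (F k) = (1 / 2) * fd (f k) (w k) (v k) * bump (a k) (t (w k))"
      unfolding L_def F_def fd_mult[OF hf hb wk] by simp
    then have "cmod (L k (F k)) = 1 / 2 * cmod (fd (f k) (w k) (v k)) * cmod (bump (a k) (t (w k)))"
      by (simp only: norm_mult) simp
    moreover have "1 / 4 \<le> cmod (bump (a k) (t (w k)))"
      by (rule cmod_bump_ge) (use a_pos Re_pos[OF wk] in \<open>auto simp: a_def\<close>)
    then have "1 / 2 * c * (1 / 4) \<le> 1 / 2 * cmod (fd (f k) (w k) (v k)) * cmod (bump (a k) (t (w k)))"
      using c by (intro mult_mono) auto
    ultimately show ?thesis by simp
  qed
  \<comment> \<open>With the functional fixed, later humps are small near \<open>w m\<close> because
    their scales tend to 0. With the hump fixed, the assumption \<open>lim\<close> applies to it as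
    a bounded function.\<close>
  have row: "(\<lambda>k. L m (F k)) \<longlonglongrightarrow> 0" for m
  proof -
    define \<rho> where "\<rho> = norm (w m)"
    have \<rho>: "0 \<le> \<rho>" "\<rho> < 1" using w by (auto simp: \<rho>_def)
    have "cmod (L m (F k)) \<le> 4 / (1 - \<rho>)\<^sup>2 * norm (v m) * a k" for k
    proof -
      have "cmod (L m (F k)) \<le> 2 * (2 * a k / (1 - \<rho>)) / (1 - \<rho>) * norm (v m)"
        unfolding L_def
      proof (rule fd_interior_bound(1)[OF hF \<rho>])
        fix y :: "complex ^ 'n" assume y: "norm y \<le> (1 + \<rho>) / 2"
        then have "(1 - \<rho>) / 2 \<le> 1 - norm y" by (simp add: field_simps)
        then have "a k / (1 - norm y) \<le> a k / ((1 - \<rho>) / 2)"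
          using \<rho> a_pos[of k] by (intro divide_left_mono) (auto intro!: mult_pos_pos)
        moreover have "norm y < 1" using y \<rho> by simp
        ultimately show "cmod (F k y) \<le> 2 * a k / (1 - \<rho>)" using F_le'[of y k] by (simp add: mult.commute)
      qed (simp add: \<rho>_def)
      then show ?thesis by (simp add: power2_eq_square mult_ac)
    qed
    moreover have "(\<lambda>k. 4 / (1 - \<rho>)\<^sup>2 * norm (v m) * a k) \<longlonglongrightarrow> 4 / (1 - \<rho>)\<^sup>2 * norm (v m) * 0"
      by (intro tendsto_intros a_lim)
    ultimately show ?thesis by (intro Lim_null_comparison[of "\<lambda>k. L m (F k)"]) auto
  qed
  have column: "(\<lambda>k. L k (F m)) \<longlonglongrightarrow> 0" for m unfolding L_def by (rule lim[OF F_Hinf])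
  \<comment> \<open>All off-diagonal terms together amount to at most
    \<open>2 * \<delta> = c / 32\<close>, against a diagonal term of at least \<open>c / 8\<close>;
    more than \<open>c / 16\<close> remains.\<close>
  define \<delta> where "\<delta> = c / 64"
  have \<delta>: "\<delta> > 0" using c by (simp add: \<delta>_def)
  have small: "\<forall>\<^sub>F k in sequentially. cmod (x k) \<le> \<delta> * (1 / 2) ^ j" if "x \<longlonglongrightarrow> 0" for x :: "nat \<Rightarrow> complex" and j
  proof -
    have "0 < \<delta> * (1 / 2) ^ j" using \<delta> by simp
    from tendstoD[OF that this] show ?thesis by eventually_elim simp
  qed
  obtain r :: "nat \<Rightarrow> nat" where r: "strict_mono r"
    and R: "\<And>i j. i < j \<Longrightarrow> a (r j) \<le> a (r i) / 2 \<and>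
      cmod (L (r j) (F (r i))) \<le> \<delta> * (1 / 2) ^ j \<and> cmod (L (r i) (F (r j))) \<le> \<delta> * (1 / 2) ^ j"
  proof (rule sparse_subsequence[of "\<lambda>j m k. a k \<le> a m / 2 \<and>
      cmod (L k (F m)) \<le> \<delta> * (1 / 2) ^ j \<and> cmod (L m (F k)) \<le> \<delta> * (1 / 2) ^ j"])
    show "\<forall>\<^sub>F k in sequentially. a k \<le> a m / 2 \<and>
      cmod (L k (F m)) \<le> \<delta> * (1 / 2) ^ j \<and> cmod (L m (F k)) \<le> \<delta> * (1 / 2) ^ j" for j m
    proof (intro eventually_conj small row column)
      have "\<forall>\<^sub>F k in sequentially. a k < a m / 2" using order_tendstoD(2)[OF a_lim half_gt_zero[OF a_pos[of m]]] .
      then show "\<forall>\<^sub>F k in sequentially. a k \<le> a m / 2" by eventually_elim simp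
    qed
  qed blast
  \<comment> \<open>The choice of \<open>r\<close> gives the power of 1/2 with the larger of the two
    indices; weakening it to \<open>i\<close> makes the bound summable over \<open>i\<close> for
    fixed \<open>j\<close>.\<close>
  have off: "cmod (L (r j) (F (r i))) \<le> \<delta> * (1 / 2) ^ i" if "i \<noteq> j" for i j
  proof (cases "i < j")
    case True
    then have "(1 / 2 :: real) ^ j \<le> (1 / 2) ^ i" by (intro power_decreasing) auto
    then have "\<delta> * (1 / 2) ^ j \<le> \<delta> * (1 / 2) ^ i" using \<delta> by simp
    then show ?thesis using R[OF True] by linarith
  next
    case False
    then show ?thesis using R[of j i] that by simp
  qed
  have a_geo: "a (r i) \<le> a (r 0) * (1 / 2) ^ i" for i
  proof (induction i)
    case (Suc i)
    have "a (r (Suc i)) \<le> a (r i) / 2" using R[of i "Suc i"] by simp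
    then show ?case using Suc by simp
  qed simp
  define H where "H = (\<lambda>N z. \<Sum>i<N. F (r i) z)"
  define S where "S = (\<lambda>z. \<Sum>i. F (r i) z)"
  have hH: "holo_on unit_ball (H N)" for N unfolding H_def by (intro holo_on_sum hF)
  have ul: "uniform_limit (cball 0 \<tau>) H S sequentially" if \<tau>: "\<tau> < 1" for \<tau>
    unfolding H_def S_def
  proof (rule Weierstrass_m_test)
    show "cmod (F (r i) z) \<le> a (r 0) * (1 / 2) ^ i / (1 - \<tau>)" if z: "z \<in> cball 0 \<tau>" for i z
    proof -
      have "norm z < 1" using z \<tau> by simp
      from F_le'[OF this] have "cmod (F (r i) z) \<le> a (r i) / (1 - norm z)" .
      also have "\<dots> \<le> a (r 0) * (1 / 2) ^ i / (1 - \<tau>)"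
        using z \<tau> a_pos[of "r 0"] by (intro frac_le a_geo) auto
      finally show ?thesis .
    qed
    show "summable (\<lambda>i. a (r 0) * (1 / 2) ^ i / (1 - \<tau>))"
      by (intro summable_divide summable_mult summable_geometric) simp
  qed
  have hS: "holo_on unit_ball S" by (rule holo_on_unit_ball_limit(1)[OF hH ul])
  \<comment> \<open>The majorants used for convergence blow up at the sphere. A bound uniform in
    \<open>z\<close> comes from the two-sided decay, with x_j the j-th scale divided by
    |t(z)|.\<close>
  have H_le: "cmod (H N z) \<le> 4" if z: "norm z < 1" for N z
  proof -
    have tz: "0 < cmod (t z)" using t_ge[of z] z by (simp del: zero_less_norm_iff)
    have "cmod (H N z) \<le> (\<Sum>i<N. min (a (r i) / cmod (t z)) (1 / (a (r i) / cmod (t z))))"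
      unfolding H_def by (rule order_trans[OF norm_sum sum_mono]) (rule F_le[OF z])
    also have "\<dots> \<le> 4"
    proof (rule sum_min_inverse_le)
      show "0 < a (r j) / cmod (t z)" for j using a_pos tz by simp
      show "a (r (Suc j)) / cmod (t z) \<le> a (r j) / cmod (t z) / 2" for j
        using R[of j "Suc j"] tz divide_right_mono[of "a (r (Suc j))" "a (r j) / 2" "cmod (t z)"]
        by (simp add: mult.commute)
    qed
    finally show ?thesis .
  qed
  have "cmod (S z) \<le> 4" if z: "z \<in> unit_ball" for z
  proof (rule tendsto_upperbound)
    show "(\<lambda>n. cmod (H n z)) \<longlonglongrightarrow> cmod (S z)"
      by (rule tendsto_norm, rule tendsto_uniform_limitI[OF ul[of "norm z"]]) (use z in auto)
  qed (use H_le z in auto)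
  then have SH: "S \<in> H_inf" using H_infI(1)[OF hS] by blast
  have "c / 16 \<le> cmod (L (r j) S)" for j
  proof (rule tendsto_lowerbound)
    have "w (r j) \<in> unit_ball" using w by simp
    then show "(\<lambda>N. cmod (L (r j) (H N))) \<longlonglongrightarrow> cmod (L (r j) S)"
      unfolding L_def by (intro tendsto_norm holo_on_unit_ball_limit(2)[OF hH ul])
    have "c / 16 \<le> cmod (L (r j) (H N))" if "j < N" for N
    proof -
      have "L (r j) (H N) = (\<Sum>i<N. L (r j) (F (r i)))"
        unfolding L_def H_def using w by (intro fd_sum[of _ unit_ball]) (auto simp: hF)
      also have "\<dots> = L (r j) (F (r j)) + (\<Sum>i\<in>{..<N} - {j}. L (r j) (F (r i)))"
        using that by (intro sum.remove) auto
      finally have 1: "L (r j) (H N) = L (r j) (F (r j)) + (\<Sum>i\<in>{..<N} - {j}. L (r j) (F (r i)))" .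
      have "cmod (\<Sum>i\<in>{..<N} - {j}. L (r j) (F (r i))) \<le> (\<Sum>i\<in>{..<N} - {j}. \<delta> * (1 / 2) ^ i)"
        by (rule order_trans[OF norm_sum sum_mono]) (auto intro!: off)
      also have "\<dots> \<le> (\<Sum>i<N. \<delta> * (1 / 2) ^ i)" using \<delta> by (intro sum_mono2) auto
      also have "\<dots> \<le> \<delta> * 2"
        unfolding sum_distrib_left[symmetric] using \<delta> by (intro mult_left_mono sum_half_powers_le) simp
      finally have "cmod (\<Sum>i\<in>{..<N} - {j}. L (r j) (F (r i))) \<le> c / 32" by (simp add: \<delta>_def)
      then show ?thesis
        unfolding 1 using diag[of "r j"] c(1)
          norm_diff_ineq[of "L (r j) (F (r j))" "\<Sum>i\<in>{..<N} - {j}. L (r j) (F (r i))"] by linarith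
    qed
    then show "\<forall>\<^sub>F N in sequentially. c / 16 \<le> cmod (L (r j) (H N))"
      by (intro eventually_mono[OF eventually_gt_at_top[of j]])
  qed simp
  moreover have "(\<lambda>j. cmod (L (r j) S)) \<longlonglongrightarrow> 0"
    using LIMSEQ_subseq_LIMSEQ[OF lim[OF SH] r] unfolding L_def o_def by (rule tendsto_norm_zero)
  ultimately have "c / 16 \<le> 0" by (intro tendsto_lowerbound[of "\<lambda>j. cmod (L (r j) S)" 0 sequentially]) auto
  with c show False by simp
qed

section \<open>From the operator to condition (c)\<close>

lemma weighted_comp_pointwise_limit:
  fixes \<phi> :: "complex ^ 'n \<Rightarrow> complex ^ 'n"
  assumes \<phi>: "holo_self_map \<phi>" and \<psi>: "\<psi> \<in> little_bloch" and f: "f \<in> H_inf"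
    and W: "weighted_comp \<psi> \<phi> f \<in> little_bloch" and \<epsilon>: "\<epsilon> > 0"
  shows "\<exists>\<rho><1. \<forall>z. \<rho> < norm z \<and> norm z < 1 \<longrightarrow>
    (\<forall>u. cmod (\<psi> z) * cmod (fd (f \<circ> \<phi>) z u) \<le> \<epsilon> * bnorm z u)"
proof -
  have h\<psi>: "holo_on unit_ball \<psi>" using \<psi> by (simp add: little_bloch_iff)
  have hf: "holo_on unit_ball f" using f by (simp add: H_inf_iff)
  define N where "N = H_inf_norm f + 1"
  have N: "0 < N" using H_inf_norm_nonneg[OF f] by (simp add: N_def)
  have fN: "cmod (f w) \<le> N" if "w \<in> unit_ball" for w
    using H_inf_norm_bound[OF f that] by (simp add: N_def)
  have "\<epsilon> / 2 / N > 0" using \<epsilon> N by simp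
  then obtain \<rho>1 where \<rho>1: "\<rho>1 < 1" "\<forall>z. \<rho>1 < norm z \<and> norm z < 1 \<longrightarrow> (\<forall>u. cmod (fd \<psi> z u) \<le> \<epsilon> / 2 / N * bnorm z u)"
    using \<psi> unfolding little_bloch_iff vanishes_at_sphere_def by blast
  obtain \<rho>2 where \<rho>2: "\<rho>2 < 1" "\<forall>z. \<rho>2 < norm z \<and> norm z < 1 \<longrightarrow>
      (\<forall>u. cmod (fd (weighted_comp \<psi> \<phi> f) z u) \<le> \<epsilon> / 2 * bnorm z u)"
    using W half_gt_zero[OF \<epsilon>] unfolding little_bloch_iff vanishes_at_sphere_def by blast
  show ?thesis
  proof (intro exI[of _ "max \<rho>1 \<rho>2"] conjI allI impI)
    fix z u :: "complex ^ 'n" assume z: "max \<rho>1 \<rho>2 < norm z \<and> norm z < 1"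
    then have zb: "z \<in> unit_ball" by simp
    \<comment> \<open>The product rule solved for the term with \<psi>: the derivative of the image
      and that of \<psi> are both small relative to \<open>bnorm\<close>, and \<open>f\<close> is
      bounded.\<close>
    have "cmod (\<psi> z) * cmod (fd (f \<circ> \<phi>) z u) = cmod (fd (weighted_comp \<psi> \<phi> f) z u - fd \<psi> z u * f (\<phi> z))"
      unfolding fd_weighted_comp[OF \<phi> h\<psi> hf zb] by (simp add: norm_mult)
    also have "\<dots> \<le> cmod (fd (weighted_comp \<psi> \<phi> f) z u) + cmod (fd \<psi> z u) * cmod (f (\<phi> z))"
      unfolding norm_mult[symmetric] by (rule norm_triangle_ineq4)
    also have "\<dots> \<le> \<epsilon> / 2 * bnorm z u + (\<epsilon> / 2 / N * bnorm z u) * N"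
    proof (intro add_mono mult_mono)
      show "cmod (f (\<phi> z)) \<le> N" using fN[of "\<phi> z"] holo_self_mapD(3)[OF \<phi> zb] by simp
      show "0 \<le> \<epsilon> / 2 / N * bnorm z u" using \<epsilon> N bnorm_nonneg[of z u] z by simp
      show "cmod (fd (weighted_comp \<psi> \<phi> f) z u) \<le> \<epsilon> / 2 * bnorm z u"
        "cmod (fd \<psi> z u) \<le> \<epsilon> / 2 / N * bnorm z u"
        using \<rho>1(2)[rule_format, of z u] \<rho>2(2)[rule_format, of z u] z by simp_all
    qed simp
    also have "\<dots> = \<epsilon> * bnorm z u" using N by simp
    finally show "cmod (\<psi> z) * cmod (fd (f \<circ> \<phi>) z u) \<le> \<epsilon> * bnorm z u" .
  qed (use \<rho>1 \<rho>2 in simp)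
qed

lemma coordinate_H_inf: "(\<lambda>z. z $ i) \<in> H_inf"
proof (rule H_infI(1)[OF holo_on_nth])
  show "cmod (z $ i) \<le> 1" if "z \<in> unit_ball" for z :: "complex ^ 'a"
    using Finite_Cartesian_Product.norm_nth_le[of z i] that by simp
qed

text \<open>On \<open>{z. norm (\<phi> z) \<le> \<tau>}\<close> the coordinate functions alone give the uniform statement.\<close>

lemma psi_theta_interior:
  fixes \<phi> :: "complex ^ 'n \<Rightarrow> complex ^ 'n"
  assumes \<phi>: "holo_self_map \<phi>" and \<psi>: "\<psi> \<in> little_bloch"
    and W: "\<And>f. f \<in> H_inf \<Longrightarrow> weighted_comp \<psi> \<phi> f \<in> little_bloch"
    and \<epsilon>: "\<epsilon> > 0" and \<tau>: "0 \<le> \<tau>" "\<tau> < 1"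
  shows "\<exists>\<rho><1. \<forall>z. \<rho> < norm z \<and> norm z < 1 \<and> norm (\<phi> z) \<le> \<tau> \<longrightarrow>
    (\<forall>f\<in>H_inf. H_inf_norm f \<le> 1 \<longrightarrow> (\<forall>u. cmod (\<psi> z) * cmod (fd (f \<circ> \<phi>) z u) \<le> \<epsilon> * bnorm z u))"
proof -
  \<comment> \<open>Chosen to undo the factor 2/(1 - \<tau>) of the interior estimate for
    \<open>f\<close> at \<phi>(z) and the sum over n coordinates.\<close>
  define e where "e = \<epsilon> * (1 - \<tau>) / 2 / real CARD('n)"
  have e: "e > 0" using \<epsilon> \<tau> by (simp add: e_def)
  have "\<exists>\<rho><1. \<forall>z. \<rho> < norm z \<and> norm z < 1 \<longrightarrow>
      (\<forall>u. cmod (\<psi> z) * cmod (fd (\<lambda>z. \<phi> z $ i) z u) \<le> e * bnorm z u)" for i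
    using weighted_comp_pointwise_limit[OF \<phi> \<psi> coordinate_H_inf W[OF coordinate_H_inf] e, of i]
    by (simp add: o_def)
  then obtain \<rho>' where \<rho>': "\<And>i. \<rho>' i < 1"
    "\<And>i z u. \<rho>' i < norm z \<and> norm z < 1 \<Longrightarrow> cmod (\<psi> z) * cmod (fd (\<lambda>z. \<phi> z $ i) z u) \<le> e * bnorm z u"
    by metis
  show ?thesis
  proof (intro exI[of _ "Max (range \<rho>')"] conjI allI impI ballI)
    show "Max (range \<rho>') < 1" using \<rho>'(1) by (subst Max_less_iff) auto
    fix z u :: "complex ^ 'n" and f :: "complex ^ 'n \<Rightarrow> complex"
    assume z: "Max (range \<rho>') < norm z \<and> norm z < 1 \<and> norm (\<phi> z) \<le> \<tau>"
      and f: "f \<in> H_inf" "H_inf_norm f \<le> 1"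
    then have zb: "z \<in> unit_ball" by simp
    have hf: "holo_on unit_ball f" using f by (simp add: H_inf_iff)
    define V where "V = (\<chi> i. fd (\<lambda>z. \<phi> z $ i) z u)"
    have "cmod (fd (f \<circ> \<phi>) z u) = cmod (fd f (\<phi> z) V)"
      unfolding V_def by (subst fd_compose[OF holo_self_mapD(1,2)[OF \<phi>] hf zb]) simp
    also have "\<dots> \<le> 2 * 1 / (1 - \<tau>) * norm V"
    proof (rule fd_interior_bound(1)[OF hf \<tau>])
      show "cmod (f w) \<le> 1" if "norm w \<le> (1 + \<tau>) / 2" for w
        using H_inf_norm_bound[OF f(1), of w] f(2) that \<tau> by simp
    qed (use z in simp)
    also have "\<dots> \<le> 2 * 1 / (1 - \<tau>) * (\<Sum>i\<in>UNIV. cmod (fd (\<lambda>z. \<phi> z $ i) z u))"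
    proof (rule mult_left_mono)
      show "norm V \<le> (\<Sum>i\<in>UNIV. cmod (fd (\<lambda>z. \<phi> z $ i) z u))"
        unfolding norm_vec_def V_def by (rule order_trans[OF L2_set_le_sum]) auto
    qed (use \<tau> in simp)
    finally have "cmod (\<psi> z) * cmod (fd (f \<circ> \<phi>) z u) \<le>
        cmod (\<psi> z) * (2 * 1 / (1 - \<tau>) * (\<Sum>i\<in>UNIV. cmod (fd (\<lambda>z. \<phi> z $ i) z u)))"
      by (rule mult_left_mono) simp
    also have "\<dots> = 2 / (1 - \<tau>) * (\<Sum>i\<in>UNIV. cmod (\<psi> z) * cmod (fd (\<lambda>z. \<phi> z $ i) z u))"
      by (simp add: sum_distrib_left mult_ac)
    also have "\<dots> \<le> 2 / (1 - \<tau>) * (\<Sum>i\<in>(UNIV :: 'n set). e * bnorm z u)"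
    proof (intro mult_left_mono sum_mono \<rho>'(2))
      fix i
      have "\<rho>' i \<le> Max (range \<rho>')" by (intro Max_ge) auto
      then show "\<rho>' i < norm z \<and> norm z < 1" using z by simp
    qed (use \<tau> in simp)
    also have "\<dots> = \<epsilon> * bnorm z u" using \<tau> by (simp add: e_def)
    finally show "cmod (\<psi> z) * cmod (fd (f \<circ> \<phi>) z u) \<le> \<epsilon> * bnorm z u" .
  qed
qed

text \<open>Weight, Bergman length and the derivative of \<phi> are absorbed into vectors v_k at the
  image points, so that the failure of uniformity becomes a statement about bounded functions and
  their derivatives at w_k = \<phi>(z_k), ready for the gliding hump.\<close>

lemma weighted_comp_little_bloch_imp_vanishes:
  fixes \<phi> :: "complex ^ 'n \<Rightarrow> complex ^ 'n"
  assumes \<phi>: "holo_self_map \<phi>" and \<psi>: "\<psi> \<in> little_bloch"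
    and W: "\<And>f. f \<in> H_inf \<Longrightarrow> weighted_comp \<psi> \<phi> f \<in> little_bloch"
  shows "psi_theta_vanishes \<psi> \<phi>"
proof (rule ccontr)
  assume "\<not> psi_theta_vanishes \<psi> \<phi>"
  then obtain \<epsilon> where \<epsilon>: "\<epsilon> > 0" and bad: "\<And>\<rho>. \<rho> < 1 \<Longrightarrow> \<exists>z f u. \<rho> < norm z \<and> norm z < 1 \<and> f \<in> H_inf \<and>
      H_inf_norm f \<le> 1 \<and> \<not> cmod (\<psi> z) * cmod (fd (f \<circ> \<phi>) z u) \<le> \<epsilon> * bnorm z u"
    unfolding psi_theta_vanishes_def by blast
  define \<tau> where "\<tau> = (\<lambda>k::nat. 1 - 1 / real (Suc k))"
  have \<tau>: "0 \<le> \<tau> k" "\<tau> k < 1" for k by (auto simp: \<tau>_def)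
  have \<tau>_lim: "\<tau> \<longlonglongrightarrow> 1"
    unfolding \<tau>_def using tendsto_diff[OF tendsto_const LIMSEQ_Suc[OF lim_1_over_n], of 1] by simp
  have "\<exists>z f u. \<tau> k < norm z \<and> norm z < 1 \<and> \<tau> k < norm (\<phi> z) \<and> f \<in> H_inf \<and> H_inf_norm f \<le> 1 \<and>
      \<epsilon> * bnorm z u < cmod (\<psi> z) * cmod (fd (f \<circ> \<phi>) z u)" for k
  proof -
    obtain \<rho> where \<rho>: "\<rho> < 1" "\<And>z f u. \<rho> < norm z \<Longrightarrow> norm z < 1 \<Longrightarrow> norm (\<phi> z) \<le> \<tau> k \<Longrightarrow> f \<in> H_inf \<Longrightarrow>
        H_inf_norm f \<le> 1 \<Longrightarrow> cmod (\<psi> z) * cmod (fd (f \<circ> \<phi>) z u) \<le> \<epsilon> * bnorm z u"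
      using psi_theta_interior[OF \<phi> \<psi> W \<epsilon> \<tau>] by blast
    \<comment> \<open>Beyond \<rho> a bad point must have an image of norm above
      \<open>\<tau> k\<close>, and beyond \<open>\<tau> k\<close> the point itself tends to the
      sphere with \<open>k\<close>.\<close>
    have "max \<rho> (\<tau> k) < 1" using \<rho>(1) \<tau> by simp
    from bad[OF this] obtain z f u where zfu: "max \<rho> (\<tau> k) < norm z" "norm z < 1" "f \<in> H_inf" "H_inf_norm f \<le> 1"
        "\<not> cmod (\<psi> z) * cmod (fd (f \<circ> \<phi>) z u) \<le> \<epsilon> * bnorm z u" by blast
    then have "\<not> norm (\<phi> z) \<le> \<tau> k" using \<rho>(2)[of z f u] by auto
    with zfu show ?thesis by (intro exI[of _ z] exI[of _ f] exI[of _ u]) auto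
  qed
  then obtain z f u where z: "\<And>k. \<tau> k < norm (z k)" "\<And>k. norm (z k) < 1" and \<phi>z: "\<And>k. \<tau> k < norm (\<phi> (z k))"
    and f: "\<And>k. f k \<in> H_inf" "\<And>k. H_inf_norm (f k) \<le> 1"
    and large: "\<And>k. \<epsilon> * bnorm (z k) (u k) < cmod (\<psi> (z k)) * cmod (fd (f k \<circ> \<phi>) (z k) (u k))"
    by metis
  have zb: "z k \<in> unit_ball" for k using z by simp
  have h: "holo_on unit_ball g" if "g \<in> H_inf" for g using that by (simp add: H_inf_iff)
  have b: "0 < bnorm (z k) (u k)" for k
  proof (rule bnorm_pos[OF z(2)])
    show "u k \<noteq> 0"
    proof
      assume "u k = 0"
      then have "fd (f k \<circ> \<phi>) (z k) (u k) = 0"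
        using fd_zero[OF holo_self_mapD(4)[OF \<phi> h[OF f(1)]] zb] by simp
      then show False using large[of k] \<epsilon> bnorm_nonneg[OF z(2), of k "u k"]
        by (simp add: mult_less_0_iff)
    qed
  qed
  define w where "w = (\<lambda>k. \<phi> (z k))"
  have w: "norm (w k) < 1" for k unfolding w_def by (rule holo_self_mapD(3)[OF \<phi> zb])
  \<comment> \<open>By the chain rule, differentiating \<open>g\<close> at \<open>w k\<close> in
    this direction gives \<psi> times the derivative of g \<circ> \<phi>, divided by the Bergman
    length of \<open>u k\<close>.\<close>
  define v where "v = (\<lambda>k. (\<psi> (z k) / of_real (bnorm (z k) (u k))) *s (\<chi> i. fd (\<lambda>z. \<phi> z $ i) (z k) (u k)))"
  have fd_v: "cmod (fd g (w k) (v k)) = cmod (\<psi> (z k)) * cmod (fd (g \<circ> \<phi>) (z k) (u k)) / bnorm (z k) (u k)"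
    if "g \<in> H_inf" for g k
  proof -
    have "fd g (w k) (v k) = \<psi> (z k) / of_real (bnorm (z k) (u k)) * fd (g \<circ> \<phi>) (z k) (u k)"
      unfolding v_def w_def using w[of k]
      by (subst fd_smult[OF h[OF that]]) (auto simp: w_def fd_compose[OF holo_self_mapD(1,2)[OF \<phi>] h[OF that] zb])
    then show ?thesis using b[of k] by (simp add: norm_mult norm_divide)
  qed
  have "w k \<in> cball 0 1" for k using w[of k] by simp
  then obtain \<xi> s where s: "strict_mono (s :: nat \<Rightarrow> nat)" "(w \<circ> s) \<longlonglongrightarrow> \<xi>"
    using compact_cball[of "0 :: complex ^ 'n" 1] unfolding compact_def by metis
  have w_lim: "(\<lambda>k. norm (w k)) \<longlonglongrightarrow> 1"
    by (rule tendsto_sandwich[OF _ _ \<tau>_lim tendsto_const]) (use \<phi>z w in \<open>auto simp: w_def less_imp_le\<close>)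
  have \<xi>: "norm \<xi> = 1"
    using LIMSEQ_unique[OF tendsto_norm[OF s(2)]] LIMSEQ_subseq_LIMSEQ[OF w_lim s(1)] by (simp add: o_def)
  have lim: "(\<lambda>k. fd g (w k) (v k)) \<longlonglongrightarrow> 0" if g: "g \<in> H_inf" for g
  proof (rule LIMSEQ_I)
    fix e :: real assume e: "e > 0"
    obtain \<rho> where \<rho>: "\<rho> < 1" "\<forall>z. \<rho> < norm z \<and> norm z < 1 \<longrightarrow>
        (\<forall>u. cmod (\<psi> z) * cmod (fd (g \<circ> \<phi>) z u) \<le> e / 2 * bnorm z u)"
      using weighted_comp_pointwise_limit[OF \<phi> \<psi> g W[OF g] half_gt_zero[OF e]] by blast
    have "\<forall>\<^sub>F k in sequentially. \<rho> < \<tau> k" using order_tendstoD(1)[OF \<tau>_lim \<rho>(1)] .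
    then obtain k0 where k0: "\<And>k. k \<ge> k0 \<Longrightarrow> \<rho> < \<tau> k" unfolding eventually_sequentially by blast
    have "norm (fd g (w k) (v k) - 0) < e" if "k \<ge> k0" for k
    proof -
      have "\<rho> < norm (z k)" using k0[OF that] z(1)[of k] by simp
      then have "cmod (\<psi> (z k)) * cmod (fd (g \<circ> \<phi>) (z k) (u k)) \<le> e / 2 * bnorm (z k) (u k)"
        using \<rho>(2) z(2) by blast
      then have "cmod (fd g (w k) (v k)) \<le> e / 2"
        unfolding fd_v[OF g] using b[of k] by (simp only: pos_divide_le_eq)
      then show ?thesis using e by simp
    qed
    then show "\<exists>k0. \<forall>k\<ge>k0. norm (fd g (w k) (v k) - 0) < e" by blast
  qed
  show False
  proof (rule gliding_hump[of "w \<circ> s" \<xi> "f \<circ> s" \<epsilon> "v \<circ> s"])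
    show "norm ((w \<circ> s) k) < 1" for k using w by simp
    show "holo_on unit_ball ((f \<circ> s) k)" for k using h[OF f(1)] by simp
    show "cmod ((f \<circ> s) k z) \<le> 1" if "norm z < 1" for k z
      using H_inf_norm_bound[OF f(1), of z "s k"] f(2)[of "s k"] that by simp
    show "\<epsilon> \<le> cmod (fd ((f \<circ> s) k) ((w \<circ> s) k) ((v \<circ> s) k))" for k
      using large[of "s k"] b[of "s k"] fd_v[OF f(1), of "s k" "s k"] by (simp add: pos_le_divide_eq)
    show "(\<lambda>k. fd g ((w \<circ> s) k) ((v \<circ> s) k)) \<longlonglongrightarrow> 0" if "g \<in> H_inf" for g
      using LIMSEQ_subseq_LIMSEQ[OF lim[OF that] s(1)] by (simp add: o_def)
  qed (fact \<xi> s(2) \<epsilon>)+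
qed

theorem corollary4p3:
  fixes \<phi> :: "complex ^ 'n \<Rightarrow> complex ^ 'n" and \<psi> :: "complex ^ 'n \<Rightarrow> complex"
  assumes "holo_self_map \<phi>" and "holo_on_ball \<psi>"
  shows "(bounded_operator H_inf H_inf_norm little_bloch bloch_norm (weighted_comp \<psi> \<phi>)
            \<longleftrightarrow> compact_operator H_inf H_inf_norm little_bloch bloch_norm (weighted_comp \<psi> \<phi>))
       \<and> (compact_operator H_inf H_inf_norm little_bloch bloch_norm (weighted_comp \<psi> \<phi>)
            \<longleftrightarrow> \<psi> \<in> little_bloch
              \<and> ((\<lambda>z. ennreal (cmod (\<psi> z)) * theta \<phi> z) \<longlongrightarrow> 0) to_sphere)"
proof -
  let ?W = "weighted_comp \<psi> \<phi>"
  have "\<psi> \<in> little_bloch \<and> psi_theta_vanishes \<psi> \<phi>"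
    if "bounded_operator H_inf H_inf_norm little_bloch bloch_norm ?W"
  proof -
    have W: "\<And>f. f \<in> H_inf \<Longrightarrow> ?W f \<in> little_bloch"
      using that by (simp add: bounded_operator_def linear_operator_def)
    \<comment> \<open>\<psi> is the image of the constant 1.\<close>
    have "(\<lambda>z. 1) \<in> H_inf" by (rule H_infI(1)[OF holo_on_const, of _ 1]) simp
    from W[OF this] have "\<psi> \<in> little_bloch" by (simp add: weighted_comp_def o_def)
    with weighted_comp_little_bloch_imp_vanishes[OF assms(1) _ W] show ?thesis by blast
  qed
  moreover have "compact_operator H_inf H_inf_norm little_bloch bloch_norm ?W"
    if "\<psi> \<in> little_bloch" "psi_theta_vanishes \<psi> \<phi>"
    using weighted_comp_compact[OF assms(1)] that by (simp add: little_bloch_iff)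
  moreover have "compact_operator H_inf H_inf_norm little_bloch bloch_norm ?W \<Longrightarrow>
      bounded_operator H_inf H_inf_norm little_bloch bloch_norm ?W"
    by (simp add: compact_operator_def)
  ultimately show ?thesis
    unfolding psi_theta_vanishes_iff[OF assms(1)] by blast
qed

end
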